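(* There exists a domain $U\subset\mathbb{R}^3$ with smooth boundary such that $U$ is uniquely determined in the class of all domains in $\mathbb{R}^3$ with smooth boundaries by the condition of local isometry of boundaries in the relative metrics, but $U$ is not convex.
   Context: A domain is an open connected set. A domain $U\subset\mathbb{R}^n$ has smooth boundary if its Euclidean boundary $\partial U$ is an $(n-1)$-dimensional submanifold of class $C^1$ without boundary in $\mathbb{R}^n$. Relative metric: for a domain $U$ with smooth boundary and $x,y\in\partial U$, $$\rho_{\partial U,U}(x,y)=\liminf_{x'\to x,\;y'\to y;\;x',y'\in U}\{\inf[l(\gamma_{x',y',U})]\},$$ where the infimum is over the lengths $l(\gamma_{x',y',U})$ of smooth paths $\gamma_{x',y',U}:[0,1]\to U$ joining $x'$ and $y'$ in $U$. Local isometry: the boundaries of domains $U$ and $V$ with smooth boundaries are locally isometric in the relative metrics if there is a bijection $f:\partial U\to\partial V$ such that for every $y\in\partial U$ there is $\varepsilon>0$ with $\rho_{\partial U,U}(a,b)=\rho_{\partial V,V}(f(a),f(b))$ for all $a,b\in\{z\in\partial U:\rho_{\partial U,U}(z,y)<\varepsilon\}$. Unique determination: a domain $U$ in a class $\mathcal{M}$ of domains in $\mathbb{R}^n$ is uniquely determined in $\mathcal{M}$ by the condition of local isometry of boundaries in the relative metrics if every $V\in\mathcal{M}$ whose boundary is locally isometric to the boundary of $U$ in the relative metrics is isometric to $U$ with respect to the Euclidean metric (i.e. there is a Euclidean isometry $J:\mathbb{R}^n\to\mathbb{R}^n$ with $J(U)=V$). *)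

theory Defs
  imports "HOL-Analysis.Analysis"
begin

definition is_domain :: "'a::euclidean_space set \<Rightarrow> bool" where
  "is_domain U \<longleftrightarrow> open U \<and> connected U"

definition C1_map_on :: "('a::euclidean_space \<Rightarrow> 'b::euclidean_space) \<Rightarrow> 'a set \<Rightarrow> bool" where
  "C1_map_on f W \<longleftrightarrow>
    (\<exists>f' :: 'a \<Rightarrow> ('a \<Rightarrow>\<^sub>L 'b).
      (\<forall>x\<in>W. (f has_derivative blinfun_apply (f' x)) (at x)) \<and> continuous_on W f')"

definition C1_diffeomorphism ::
    "'a::euclidean_space set \<Rightarrow> 'b::euclidean_space set \<Rightarrow> ('a \<Rightarrow> 'b) \<Rightarrow> ('b \<Rightarrow> 'a) \<Rightarrow> bool" where
  "C1_diffeomorphism W W' \<phi> \<psi> \<longleftrightarrow>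
    open W \<and> open W' \<and> homeomorphism W W' \<phi> \<psi> \<and> C1_map_on \<phi> W \<and> C1_map_on \<psi> W'"

text \<open>Embedded \<open>k\<close>-dimensional submanifolds of class \<open>C\<^sup>1\<close> without boundary: near each of its
  points, \<open>M\<close> is straightened onto a \<open>k\<close>-dimensional linear subspace by a diffeomorphism
  between open subsets of the ambient space. The empty set qualifies for every \<open>k\<close>.\<close>

definition C1_submanifold :: "nat \<Rightarrow> 'a::euclidean_space set \<Rightarrow> bool" where
  "C1_submanifold k M \<longleftrightarrow>
    (\<forall>p\<in>M. \<exists>W W' \<phi> \<psi> (S :: 'a set).
      p \<in> W \<and> C1_diffeomorphism W W' \<phi> \<psi> \<and> subspace S \<and> dim S = k \<and>
      \<phi> ` (M \<inter> W) = S \<inter> W')"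

definition smooth_boundary :: "'a::euclidean_space set \<Rightarrow> bool" where
  "smooth_boundary U \<longleftrightarrow> C1_submanifold (DIM('a) - 1) (frontier U)"

definition smooth_domains :: "'a::euclidean_space set set" where
  "smooth_domains = {U. is_domain U \<and> smooth_boundary U}"

text \<open>Smooth means \<open>C\<^sup>1\<close>. The library predicate \<open>C1_differentiable_on\<close> asks for two-sided derivatives
  at \<open>0\<close> and \<open>1\<close>; this is no restriction, as a \<open>C\<^sup>1\<close> path on \<open>{0..1}\<close> extends affinely past its
  endpoints, and only its values on \<open>{0..1}\<close> matter.\<close>

definition smooth_paths_in :: "'a::euclidean_space set \<Rightarrow> 'a \<Rightarrow> 'a \<Rightarrow> (real \<Rightarrow> 'a) set" where
  "smooth_paths_in U x y =
    {\<gamma>. \<gamma> C1_differentiable_on {0..1} \<and> path_image \<gamma> \<subseteq> U \<and> pathstart \<gamma> = x \<and> pathfinish \<gamma> = y}"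

definition smooth_path_length :: "(real \<Rightarrow> 'a::euclidean_space) \<Rightarrow> real" where
  "smooth_path_length \<gamma> = integral {0..1} (\<lambda>t. norm (vector_derivative \<gamma> (at t)))"

text \<open>Values are taken in \<open>ennreal\<close>, where the infimum over an empty set of paths and a divergent
  lower limit are \<open>\<infinity>\<close>.\<close>

definition inner_dist :: "'a::euclidean_space set \<Rightarrow> 'a \<Rightarrow> 'a \<Rightarrow> ennreal" where
  "inner_dist U x y = (INF \<gamma>\<in>smooth_paths_in U x y. ennreal (smooth_path_length \<gamma>))"

definition relative_metric :: "'a::euclidean_space set \<Rightarrow> 'a \<Rightarrow> 'a \<Rightarrow> ennreal" where
  "relative_metric U x y =
    Liminf ((at x within U) \<times>\<^sub>F (at y within U)) (\<lambda>(x', y'). inner_dist U x' y')"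

definition locally_isometric_boundaries ::
    "'a::euclidean_space set \<Rightarrow> 'a set \<Rightarrow> bool" where
  "locally_isometric_boundaries U V \<longleftrightarrow>
    (\<exists>f. bij_betw f (frontier U) (frontier V) \<and>
      (\<forall>y\<in>frontier U. \<exists>\<epsilon>::real. \<epsilon> > 0 \<and>
        (\<forall>a\<in>{z \<in> frontier U. relative_metric U z y < ennreal \<epsilon>}.
         \<forall>b\<in>{z \<in> frontier U. relative_metric U z y < ennreal \<epsilon>}.
          relative_metric U a b = relative_metric V (f a) (f b))))"

definition euclidean_isometric :: "'a::euclidean_space set \<Rightarrow> 'a set \<Rightarrow> bool" where
  "euclidean_isometric U V \<longleftrightarrow>
    (\<exists>J :: 'a \<Rightarrow> 'a. (\<forall>x y. dist (J x) (J y) = dist x y) \<and> J ` U = V)"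

definition uniquely_determined_in :: "'a::euclidean_space set set \<Rightarrow> 'a set \<Rightarrow> bool" where
  "uniquely_determined_in \<M> U \<longleftrightarrow>
    U \<in> \<M> \<and> (\<forall>V\<in>\<M>. locally_isometric_boundaries U V \<longrightarrow> euclidean_isometric U V)"

end

theory Submission
  imports Defs
begin

text \<open>
  The domain is the region above the saddle \<open>z = x y\<close>. The idea is that a local isometry in the
  relative metrics recognises the chords of the boundary that run inside the domain, and that the saddle
  has enough of them to be rigid.

  If the open segment between two boundary points \<open>a\<close> and \<open>b\<close> lies inside \<open>U\<close>, their relative distance is
  \<open>dist a b\<close>, and no third boundary point \<open>c\<close> satisfies \<open>dist a c + dist c b = dist a b\<close>. A local isometry
  \<open>f\<close> onto the boundary of \<open>V\<close> carries both properties over to relative distances in \<open>V\<close>: no boundary point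
  of \<open>V\<close> lies metrically between \<open>f a\<close> and \<open>f b\<close>. A shortest connection between them cannot
  touch the boundary on its way, so it is a segment and \<open>dist (f a) (f b) = dist a b\<close>. The locale
  \<open>nongrazing_pair\<close> contains this argument, and \<open>visible_chord_length\<close> applies it to the saddle.
  Invariance of domain enters there because boundary points of \<open>V\<close> near \<open>f a\<close> must come from points
  near \<open>a\<close>, where \<open>f\<close> is known to be isometric.

  In the parametrisation \<open>(u, v, u v)\<close> the chord between two parameters runs above the saddle exactly if
  the parameters differ strictly and in the same direction in both coordinates. In the limit the rulings
  keep their lengths too, so \<open>f\<close> is affine along rulings, and \<open>comparable_chords_rigid\<close> concludes that
  \<open>f\<close> is locally the restriction of a Euclidean isometry. These local isometries coincide because the
  plane of parameters is connected.

  Hence the boundary of \<open>V\<close> is a congruent copy of the saddle and \<open>V\<close> is one of its two sides. The sides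
  are congruent by the half-turn \<open>(x, y, z) \<mapsto> (- x, y, - z)\<close>, so it does not matter which.
\<close>

section \<open>Paths of bounded length\<close>

text \<open>Inequalities between infima of lengths are stated through paths of length at most \<open>l\<close>, so that
estimates stay within the real numbers.\<close>

definition joined_within :: "'a::euclidean_space set \<Rightarrow> 'a \<Rightarrow> 'a \<Rightarrow> real \<Rightarrow> bool" where
  "joined_within V x y l \<longleftrightarrow> (\<exists>\<gamma>\<in>smooth_paths_in V x y. smooth_path_length \<gamma> \<le> l)"

lemma smooth_path_velocity:
  assumes "\<gamma> \<in> smooth_paths_in V x y"
  obtains D where "\<And>t. t \<in> {0..1} \<Longrightarrow> (\<gamma> has_vector_derivative D t) (at t)"
    "continuous_on {0..1} D" "smooth_path_length \<gamma> = integral {0..1} (\<lambda>t. norm (D t))"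
    "\<gamma> ` {0..1} \<subseteq> V" "\<gamma> 0 = x" "\<gamma> 1 = y"
proof -
  from assms obtain D where D: "\<And>t. t \<in> {0..1} \<Longrightarrow> (\<gamma> has_vector_derivative D t) (at t)"
      "continuous_on {0..1} D"
    unfolding smooth_paths_in_def C1_differentiable_on_def by blast
  have "smooth_path_length \<gamma> = integral {0..1} (\<lambda>t. norm (D t))"
    unfolding smooth_path_length_def
    by (rule integral_cong) (simp add: D(1)[THEN vector_derivative_at])
  then show ?thesis
    using that[OF D] assms by (auto simp: smooth_paths_in_def path_image_def pathstart_def pathfinish_def)
qed

lemma joined_withinI:
  assumes "\<And>t. t \<in> {0..1} \<Longrightarrow> (\<gamma> has_vector_derivative D t) (at t)"
    and "continuous_on {0..1} D" and "\<gamma> ` {0..1} \<subseteq> V" and "\<gamma> 0 = x" and "\<gamma> 1 = y"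
    and "integral {0..1} (\<lambda>t. norm (D t)) \<le> l"
  shows "joined_within V x y l"
proof -
  have "smooth_path_length \<gamma> = integral {0..1} (\<lambda>t. norm (D t))"
    unfolding smooth_path_length_def
    by (rule integral_cong) (simp add: assms(1)[THEN vector_derivative_at])
  moreover have "\<gamma> \<in> smooth_paths_in V x y"
    using assms(1-5) unfolding smooth_paths_in_def C1_differentiable_on_def mem_Collect_eq
    by (intro conjI exI[of _ D]) (auto simp: path_image_def pathstart_def pathfinish_def)
  ultimately show ?thesis using assms(6) unfolding joined_within_def by (intro bexI[of _ \<gamma>]) simp_all
qed

lemma joined_within_mono: "joined_within V x y l \<Longrightarrow> l \<le> m \<Longrightarrow> joined_within V x y m"
  unfolding joined_within_def by force

lemma joined_within_mem: "joined_within V x y l \<Longrightarrow> x \<in> V \<and> y \<in> V"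
  unfolding joined_within_def smooth_paths_in_def by (auto simp: pathfinish_in_path_image pathstart_in_path_image subset_iff)

lemma joined_within_dist_le:
  assumes "joined_within V x y l" shows "dist x y \<le> l"
proof -
  obtain \<gamma> where \<gamma>: "\<gamma> \<in> smooth_paths_in V x y" "smooth_path_length \<gamma> \<le> l"
    using assms unfolding joined_within_def by blast
  obtain D where D: "\<And>t. t \<in> {0..1} \<Longrightarrow> (\<gamma> has_vector_derivative D t) (at t)"
    "continuous_on {0..1} D" "smooth_path_length \<gamma> = integral {0..1} (\<lambda>t. norm (D t))"
    "\<gamma> 0 = x" "\<gamma> 1 = y"
    using smooth_path_velocity[OF \<gamma>(1)] by metis
  have "(D has_integral (\<gamma> 1 - \<gamma> 0)) {0..1}"
    by (rule fundamental_theorem_of_calculus) (simp_all add: D(1) has_vector_derivative_at_within)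
  then have "norm (\<gamma> 1 - \<gamma> 0) \<le> integral {0..1} (\<lambda>t. norm (D t))"
    using integral_norm_bound_integral[of D "{0..1}" "\<lambda>t. norm (D t)"] D(2)
    by (metis integrable_continuous_interval continuous_on_norm integral_unique order_refl)
  then show ?thesis using D \<gamma> by (simp add: dist_norm norm_minus_commute)
qed

lemma joined_within_segment:
  assumes "closed_segment x y \<subseteq> V" shows "joined_within V x y (dist x y)"
proof (rule joined_withinI)
  show "(linepath x y has_vector_derivative (y - x)) (at t)" for t
    by (rule has_vector_derivative_linepath_within)
  show "linepath x y ` {0..1} \<subseteq> V"
    using assms path_image_linepath[of x y] by (simp add: path_image_def)
qed (auto simp: linepath_def dist_norm norm_minus_commute)

text \<open>If \<open>N\<close> is the speed of a path and \<open>s\<close> is increasing, the integrand is the speed of the path run through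
with parameter \<open>s\<close>.\<close>

lemma reparametrised_length:
  fixes N :: "real \<Rightarrow> real"
  assumes N: "continuous_on {0..1} N"
    and s: "\<And>t. t \<in> {0..1} \<Longrightarrow> (s has_real_derivative s' t) (at t)"
    and im: "s ` {0..1} \<subseteq> {0..1}" and le: "s 0 \<le> s 1"
  shows "((\<lambda>t. s' t * N (s t)) has_integral integral {s 0..s 1} N) {0..1}"
  using has_integral_substitution[of 0 1 s 0 1 N s'] assms
  by (auto intro: has_field_derivative_at_within)

lemma joined_within_reparam:
  assumes D: "\<And>t. t \<in> {0..1} \<Longrightarrow> (\<gamma> has_vector_derivative D t) (at t)"
    and cD: "continuous_on {0..1} D" and \<gamma>: "\<gamma> ` {0..1} \<subseteq> V"
    and pq: "0 \<le> p" "p \<le> q" "q \<le> 1"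
  shows "joined_within V (\<gamma> p) (\<gamma> q) (integral {p..q} (\<lambda>t. norm (D t)))"
proof -
  define s where "s = (\<lambda>t. p + t * (q - p))"
  have s1: "(s has_real_derivative (q - p)) (at t)" for t
    unfolding s_def by (auto intro!: derivative_eq_intros)
  have sub: "s ` {0..1} \<subseteq> {0..1}"
  proof -
    have "0 \<le> s t \<and> s t \<le> 1" if "t \<in> {0..1}" for t
      using that pq mult_left_le_one_le[of "q - p" t] unfolding s_def by (auto intro!: add_nonneg_nonneg)
    then show ?thesis by auto
  qed
  have cs: "continuous_on {0..1} s" unfolding s_def by (intro continuous_intros)
  have int: "((\<lambda>t. (q - p) * norm (D (s t))) has_integral integral {s 0..s 1} (\<lambda>t. norm (D t))) {0..1}"
    by (rule reparametrised_length[of "\<lambda>t. norm (D t)" s "\<lambda>_. q - p"])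
       (use sub s1 cD pq in \<open>auto intro!: continuous_intros simp: s_def\<close>)
  show ?thesis
  proof (rule joined_withinI)
    show "((\<gamma> \<circ> s) has_vector_derivative ((q - p) *\<^sub>R D (s t))) (at t)" if "t \<in> {0..1}" for t
    proof (rule vector_diff_chain_at)
      show "(s has_vector_derivative q - p) (at t)"
        using s1 has_real_derivative_iff_has_vector_derivative by blast
      show "(\<gamma> has_vector_derivative D (s t)) (at (s t))" using D sub that by blast
    qed
    show "continuous_on {0..1} (\<lambda>t. (q - p) *\<^sub>R D (s t))"
      by (intro continuous_intros continuous_on_compose2[OF cD cs sub])
    show "(\<gamma> \<circ> s) ` {0..1} \<subseteq> V" using sub \<gamma> by fastforce
    show "integral {0..1} (\<lambda>t. norm ((q - p) *\<^sub>R D (s t))) \<le> integral {p..q} (\<lambda>t. norm (D t))"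
      using integral_unique[OF int] pq by (simp add: s_def)
  qed (auto simp: s_def)
qed

text \<open>The length of an initial piece of a path depends continuously on where it ends, so the path can
be cut after any prescribed length.\<close>

lemma joined_within_split:
  assumes "joined_within V x y l" and "0 \<le> s" "s \<le> l"
  obtains z where "joined_within V x z s" "joined_within V z y (l - s)"
proof -
  obtain \<gamma> where \<gamma>: "\<gamma> \<in> smooth_paths_in V x y" "smooth_path_length \<gamma> \<le> l"
    using assms unfolding joined_within_def by blast
  obtain D where D: "\<And>t. t \<in> {0..1} \<Longrightarrow> (\<gamma> has_vector_derivative D t) (at t)"
    "continuous_on {0..1} D" "smooth_path_length \<gamma> = integral {0..1} (\<lambda>t. norm (D t))"
    "\<gamma> ` {0..1} \<subseteq> V" "\<gamma> 0 = x" "\<gamma> 1 = y"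
    using smooth_path_velocity[OF \<gamma>(1)] by metis
  let ?N = "\<lambda>t. norm (D t)"
  have cN: "continuous_on {0..1} ?N" using D(2) by (intro continuous_intros)
  then have iN: "?N integrable_on {0..1}" by (rule integrable_continuous_interval)
  obtain \<tau> where \<tau>: "0 \<le> \<tau>" "\<tau> \<le> 1" "integral {0..\<tau>} ?N \<le> s" "integral {\<tau>..1} ?N \<le> l - s"
  proof (cases "integral {0..1} ?N \<le> s")
    case True then show ?thesis using that[of 1] assms by simp
  next
    case False
    have "\<exists>\<tau>\<ge>0. \<tau> \<le> 1 \<and> integral {0..\<tau>} ?N = s"
      by (rule IVT'[of "\<lambda>\<tau>. integral {0..\<tau>} ?N"])
         (use False assms iN in \<open>auto intro: indefinite_integral_continuous_1\<close>)
    then obtain \<tau> where t: "0 \<le> \<tau>" "\<tau> \<le> 1" "integral {0..\<tau>} ?N = s" by blast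
    have "integral {0..\<tau>} ?N + integral {\<tau>..1} ?N = integral {0..1} ?N"
      using Henstock_Kurzweil_Integration.integral_combine[OF t(1,2) iN] .
    then show ?thesis using that[of \<tau>] t D(3) \<gamma>(2) by simp
  qed
  show ?thesis
  proof
    show "joined_within V x (\<gamma> \<tau>) s"
      using joined_within_mono[OF joined_within_reparam[OF D(1,2,4), of 0 \<tau>]] \<tau> D by auto
    show "joined_within V (\<gamma> \<tau>) y (l - s)"
      using joined_within_mono[OF joined_within_reparam[OF D(1,2,4), of \<tau> 1]] \<tau> D by auto
  qed
qed

text \<open>The squared positive part is the simplest function that leaves \<open>0\<close> in a continuously
differentiable way; it serves to stop and restart a path at a junction.\<close>

lemma positive_part_square_derivative:
  "((\<lambda>x::real. (max 0 x)\<^sup>2) has_real_derivative 2 * max 0 x) (at x)"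
proof (cases "x = 0")
  case False
  show ?thesis
  proof (rule DERIV_cong_ev[THEN iffD2, OF refl _ refl])
    show "\<forall>\<^sub>F y in nhds x. (max 0 y)\<^sup>2 = (if x > 0 then y\<^sup>2 else 0)"
      unfolding eventually_nhds_metric using False
      by (intro exI[of _ "\<bar>x\<bar>"]) (auto simp: dist_real_def max_def)
    show "((\<lambda>y. if x > 0 then y\<^sup>2 else 0) has_real_derivative 2 * max 0 x) (at x)"
      using False by (cases "x > 0") (auto intro!: derivative_eq_intros simp: max_def)
  qed
next
  case True
  have "(\<lambda>h. (max 0 h)\<^sup>2 / h) \<midarrow>0\<rightarrow> (0::real)"
  proof (rule Lim_null_comparison)
    show "\<forall>\<^sub>F h in at 0. norm ((max 0 h)\<^sup>2 / h) \<le> \<bar>h::real\<bar>"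
      by (rule always_eventually) (auto simp: max_def power2_eq_square)
    show "((\<lambda>h::real. \<bar>h\<bar>) \<longlongrightarrow> 0) (at 0)" by (rule tendsto_eq_intros | simp)+
  qed
  then show ?thesis using True by (simp add: DERIV_def)
qed

text \<open>Running two paths one after the other creates a corner at the junction. It disappears when both
paths are slowed down to velocity zero there. With \<open>s1\<close> rising from \<open>0\<close> to \<open>1\<close> on the first half of the
unit interval and \<open>s2\<close> on the second half, the path \<open>\<gamma>1 \<circ> s1 + \<gamma>2 \<circ> s2 - y\<close> does this in one formula,
because at every time one of its two moving parts rests at the junction \<open>y\<close>.\<close>

lemma joined_within_trans:
  assumes "joined_within V x y l" and "joined_within V y z m"
  shows "joined_within V x z (l + m)"
proof -
  obtain \<gamma>1 where \<gamma>1: "\<gamma>1 \<in> smooth_paths_in V x y" "smooth_path_length \<gamma>1 \<le> l"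
    using assms unfolding joined_within_def by blast
  obtain D1 where D1: "\<And>t. t \<in> {0..1} \<Longrightarrow> (\<gamma>1 has_vector_derivative D1 t) (at t)"
    "continuous_on {0..1} D1" "smooth_path_length \<gamma>1 = integral {0..1} (\<lambda>t. norm (D1 t))"
    "\<gamma>1 ` {0..1} \<subseteq> V" "\<gamma>1 0 = x" "\<gamma>1 1 = y"
    using smooth_path_velocity[OF \<gamma>1(1)] by metis
  obtain \<gamma>2 where \<gamma>2: "\<gamma>2 \<in> smooth_paths_in V y z" "smooth_path_length \<gamma>2 \<le> m"
    using assms unfolding joined_within_def by blast
  obtain D2 where D2: "\<And>t. t \<in> {0..1} \<Longrightarrow> (\<gamma>2 has_vector_derivative D2 t) (at t)"
    "continuous_on {0..1} D2" "smooth_path_length \<gamma>2 = integral {0..1} (\<lambda>t. norm (D2 t))"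
    "\<gamma>2 ` {0..1} \<subseteq> V" "\<gamma>2 0 = y" "\<gamma>2 1 = z"
    using smooth_path_velocity[OF \<gamma>2(1)] by metis
  define s1 :: "real \<Rightarrow> real" where "s1 = (\<lambda>t. 1 - (max 0 (1 - 2 * t))\<^sup>2)"
  define s2 :: "real \<Rightarrow> real" where "s2 = (\<lambda>t. (max 0 (2 * t - 1))\<^sup>2)"
  define v1 :: "real \<Rightarrow> real" where "v1 = (\<lambda>t. 4 * max 0 (1 - 2 * t))"
  define v2 :: "real \<Rightarrow> real" where "v2 = (\<lambda>t. 4 * max 0 (2 * t - 1))"
  have ds1: "(s1 has_real_derivative v1 t) (at t)" for t
  proof -
    have "((\<lambda>t. (max 0 (1 - 2 * t))\<^sup>2) has_real_derivative 2 * max 0 (1 - 2 * t) * (- 2)) (at t)"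
      by (rule DERIV_chain2[OF positive_part_square_derivative]) (auto intro!: derivative_eq_intros)
    from DERIV_diff[OF DERIV_const this, of 1] show ?thesis unfolding s1_def v1_def by simp
  qed
  have ds2: "(s2 has_real_derivative v2 t) (at t)" for t
  proof -
    have "((\<lambda>t. (max 0 (2 * t - 1))\<^sup>2) has_real_derivative 2 * max 0 (2 * t - 1) * (2)) (at t)"
      by (rule DERIV_chain2[OF positive_part_square_derivative]) (auto intro!: derivative_eq_intros)
    then show ?thesis unfolding s2_def v2_def by simp
  qed
  have sub1: "s1 ` {0..1} \<subseteq> {0..1}" and sub2: "s2 ` {0..1} \<subseteq> {0..1}"
    unfolding s1_def s2_def by (auto simp: max_def power_le_one_iff abs_square_le_1)
  have cs: "continuous_on {0..1} s1" "continuous_on {0..1} s2" "continuous_on {0..1} v1" "continuous_on {0..1} v2"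
    unfolding s1_def s2_def v1_def v2_def by (intro continuous_intros)+
  have v0: "v1 t \<ge> 0" "v2 t \<ge> 0" for t unfolding v1_def v2_def by auto
  define D where "D = (\<lambda>t. v1 t *\<^sub>R D1 (s1 t) + v2 t *\<^sub>R D2 (s2 t))"
  have i1: "((\<lambda>t. v1 t * norm (D1 (s1 t))) has_integral integral {s1 0..s1 1} (\<lambda>t. norm (D1 t))) {0..1}"
    by (rule reparametrised_length[of "\<lambda>t. norm (D1 t)"])
       (use sub1 ds1 D1 in \<open>auto intro!: continuous_intros simp: s1_def\<close>)
  have i2: "((\<lambda>t. v2 t * norm (D2 (s2 t))) has_integral integral {s2 0..s2 1} (\<lambda>t. norm (D2 t))) {0..1}"
    by (rule reparametrised_length[of "\<lambda>t. norm (D2 t)"])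
       (use sub2 ds2 D2 in \<open>auto intro!: continuous_intros simp: s2_def\<close>)
  have cD: "continuous_on {0..1} D"
    unfolding D_def
    by (intro continuous_intros cs continuous_on_compose2[OF D1(2) cs(1) sub1]
      continuous_on_compose2[OF D2(2) cs(2) sub2])
  show ?thesis
  proof (rule joined_withinI)
    show "((\<lambda>t. \<gamma>1 (s1 t) + \<gamma>2 (s2 t) - y) has_vector_derivative D t) (at t)" if "t \<in> {0..1}" for t
    proof -
      have "((\<gamma>1 \<circ> s1) has_vector_derivative (v1 t *\<^sub>R D1 (s1 t))) (at t)"
        by (rule vector_diff_chain_at)
           (use ds1 D1(1) sub1 that in \<open>auto simp: has_real_derivative_iff_has_vector_derivative[symmetric] image_subset_iff\<close>)
      moreover have "((\<gamma>2 \<circ> s2) has_vector_derivative (v2 t *\<^sub>R D2 (s2 t))) (at t)"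
        by (rule vector_diff_chain_at)
           (use ds2 D2(1) sub2 that in \<open>auto simp: has_real_derivative_iff_has_vector_derivative[symmetric] image_subset_iff\<close>)
      ultimately show ?thesis unfolding D_def o_def
        by (auto intro!: derivative_eq_intros)
    qed
    show "continuous_on {0..1} D" by (rule cD)
    show "(\<lambda>t. \<gamma>1 (s1 t) + \<gamma>2 (s2 t) - y) ` {0..1} \<subseteq> V"
    proof clarsimp
      fix t :: real assume t: "0 \<le> t" "t \<le> 1"
      show "\<gamma>1 (s1 t) + \<gamma>2 (s2 t) - y \<in> V"
      proof (cases "t \<le> 1/2")
        case True
        then have "s2 t = 0" by (simp add: s2_def)
        moreover have "s1 t \<in> {0..1}" using sub1 t by (auto simp: image_subset_iff)
        ultimately show ?thesis using D1(4) D2(5) by auto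
      next
        case False
        then have "s1 t = 1" by (simp add: s1_def)
        moreover have "s2 t \<in> {0..1}" using sub2 t by (auto simp: image_subset_iff)
        ultimately show ?thesis using D2(4) D1(6) by auto
      qed
    qed
    have "integral {0..1} (\<lambda>t. norm (D t)) \<le> integral {0..1} (\<lambda>t. v1 t * norm (D1 (s1 t)) + v2 t * norm (D2 (s2 t)))"
    proof (rule integral_le)
      show "(\<lambda>t. norm (D t)) integrable_on {0..1}"
        by (intro integrable_continuous_interval continuous_intros cD)
      show "(\<lambda>t. v1 t * norm (D1 (s1 t)) + v2 t * norm (D2 (s2 t))) integrable_on {0..1}"
        using has_integral_add[OF i1 i2] by blast
      show "norm (D t) \<le> v1 t * norm (D1 (s1 t)) + v2 t * norm (D2 (s2 t))" for t
        unfolding D_def using norm_triangle_ineq v0 by (metis abs_of_nonneg norm_scaleR)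
    qed
    also have "\<dots> = integral {s1 0..s1 1} (\<lambda>t. norm (D1 t)) + integral {s2 0..s2 1} (\<lambda>t. norm (D2 t))"
      using has_integral_add[OF i1 i2] by (rule integral_unique)
    also have "\<dots> \<le> l + m"
      using \<gamma>1 \<gamma>2 D1(3) D2(3) by (simp add: s1_def s2_def)
    finally show "integral {0..1} (\<lambda>t. norm (D t)) \<le> l + m" .
  qed (auto simp: s1_def s2_def D1 D2)
qed

lemma joined_within_iff_inner_dist:
  assumes "0 \<le> l"
  shows "inner_dist V x y \<le> ennreal l \<longleftrightarrow> (\<forall>e>0. joined_within V x y (l + e))"
proof
  assume le: "inner_dist V x y \<le> ennreal l"
  show "\<forall>e>0. joined_within V x y (l + e)"
  proof (intro allI impI)
    fix e :: real assume "e > 0"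
    then have "inner_dist V x y < ennreal (l + e)"
      using le assms by (metis ennreal_lessI le_less_trans less_add_same_cancel1 add_pos_nonneg add.commute)
    then obtain \<gamma> where "\<gamma> \<in> smooth_paths_in V x y" "ennreal (smooth_path_length \<gamma>) < ennreal (l + e)"
      unfolding inner_dist_def INF_less_iff by blast
    then show "joined_within V x y (l + e)"
      unfolding joined_within_def using \<open>e > 0\<close> assms
      by (metis ennreal_less_iff ennreal_neg less_imp_le linorder_le_cases order_trans add_nonneg_nonneg)
  qed
next
  assume *: "\<forall>e>0. joined_within V x y (l + e)"
  show "inner_dist V x y \<le> ennreal l"
  proof (rule ennreal_le_epsilon)
    fix e :: real assume "e > 0"
    then obtain \<gamma> where "\<gamma> \<in> smooth_paths_in V x y" "smooth_path_length \<gamma> \<le> l + e"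
      using * unfolding joined_within_def by blast
    then have "inner_dist V x y \<le> ennreal (l + e)"
      unfolding inner_dist_def by (meson INF_lower2 ennreal_leI)
    then show "inner_dist V x y \<le> ennreal l + ennreal e"
      using assms \<open>e > 0\<close> by (simp add: ennreal_plus)
  qed
qed

text \<open>At points outside \<open>V\<close> the punctured neighbourhoods in the lower limit lose nothing, and
the lower limit becomes the existence of short paths between points arbitrarily close by.\<close>

lemma relative_metric_le_iff:
  assumes c: "0 \<le> c" and "x \<notin> V" "y \<notin> V"
  shows "relative_metric V x y \<le> ennreal c \<longleftrightarrow>
    (\<forall>e>0. \<exists>x' y'. dist x' x < e \<and> dist y' y < e \<and> joined_within V x' y' (c + e))"
proof
  assume le: "relative_metric V x y \<le> ennreal c"
  show "\<forall>e>0. \<exists>x' y'. dist x' x < e \<and> dist y' y < e \<and> joined_within V x' y' (c + e)"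
  proof (intro allI impI, rule ccontr)
    fix e :: real assume e: "e > 0"
    assume no: "\<not> (\<exists>x' y'. dist x' x < e \<and> dist y' y < e \<and> joined_within V x' y' (c + e))"
    have "ennreal (c + e/2) \<le> relative_metric V x y"
      unfolding relative_metric_def
    proof (rule Liminf_bounded)
      have far: "ennreal (c + e/2) \<le> inner_dist V x' y'" if "dist x' x < e" "dist y' y < e" for x' y'
      proof (rule ccontr)
        assume "\<not> ennreal (c + e/2) \<le> inner_dist V x' y'"
        then have "joined_within V x' y' (c + e/2 + e/2)"
          using joined_within_iff_inner_dist[of "c + e/2" V x' y'] c e
          by (meson add_nonneg_nonneg half_gt_zero less_imp_le not_le)
        then have "joined_within V x' y' (c + e)" by (simp add: add.commute)
        with no that show False by blast
      qed
      show "\<forall>\<^sub>F p in (at x within V) \<times>\<^sub>F (at y within V). ennreal (c + e/2) \<le> (case p of (x', y') \<Rightarrow> inner_dist V x' y')"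
        unfolding eventually_prod_filter
        by (intro exI[of _ "\<lambda>x'. dist x' x < e"] exI[of _ "\<lambda>y'. dist y' y < e"] conjI)
           (use e far in \<open>auto simp: eventually_at\<close>)
    qed
    with le have "ennreal (c + e/2) \<le> ennreal c" by order
    with e c show False by simp
  qed
next
  assume *: "\<forall>e>0. \<exists>x' y'. dist x' x < e \<and> dist y' y < e \<and> joined_within V x' y' (c + e)"
  show "relative_metric V x y \<le> ennreal c"
  proof (rule ccontr)
    assume "\<not> ?thesis"
    then obtain b where b: "ennreal c < b" "b < relative_metric V x y"
      by (metis dense not_le)
    then have "\<forall>\<^sub>F p in (at x within V) \<times>\<^sub>F (at y within V). b < (case p of (x', y') \<Rightarrow> inner_dist V x' y')"
      unfolding relative_metric_def using le_Liminf_iff by blast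
    then obtain Pf Pg where P: "eventually Pf (at x within V)" "eventually Pg (at y within V)"
      "\<And>x' y'. Pf x' \<Longrightarrow> Pg y' \<Longrightarrow> b < inner_dist V x' y'"
      unfolding eventually_prod_filter by auto
    obtain d1 where d1: "d1 > 0" "\<And>x'. x' \<in> V \<Longrightarrow> x' \<noteq> x \<Longrightarrow> dist x' x < d1 \<Longrightarrow> Pf x'"
      using P(1) unfolding eventually_at by blast
    obtain d2 where d2: "d2 > 0" "\<And>y'. y' \<in> V \<Longrightarrow> y' \<noteq> y \<Longrightarrow> dist y' y < d2 \<Longrightarrow> Pg y'"
      using P(2) unfolding eventually_at by blast
    \<comment> \<open>A real margin below \<open>b\<close>, which may be infinite.\<close>
    obtain r where r: "r > 0" "ennreal (c + r) \<le> b"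
    proof (cases b)
      case (real r')
      then show ?thesis using b c that[of "r' - c"] by (simp add: ennreal_less_iff)
    next
      case top then show ?thesis using that[of 1] by simp
    qed
    define e where "e = min r (min d1 d2) / 2"
    have e: "e > 0" "e < d1" "e < d2" "e < r" using d1 d2 r unfolding e_def by (auto simp: min_def)
    obtain x' y' where xy: "dist x' x < e" "dist y' y < e" "joined_within V x' y' (c + e)"
      using * e by blast
    then have "x' \<in> V" "y' \<in> V" using joined_within_mem by blast+
    then have "b < inner_dist V x' y'"
      using P(3) d1(2)[of x'] d2(2)[of y'] xy e assms by force
    moreover have "inner_dist V x' y' \<le> ennreal (c + e)"
      using xy(3) joined_within_iff_inner_dist[of "c + e" V x' y'] c e joined_within_mono
      by (metis add_nonneg_nonneg less_imp_le less_add_same_cancel1)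
    moreover have "ennreal (c + e) \<le> ennreal (c + r)" using e by (intro ennreal_leI) simp
    ultimately show False using r by order
  qed
qed

lemma relative_metric_imp_dist_le:
  assumes "relative_metric V x y \<le> ennreal c" and "0 \<le> c" "x \<notin> V" "y \<notin> V"
  shows "dist x y \<le> c"
proof (rule field_le_epsilon)
  fix e :: real assume "e > 0"
  then have "e/3 > 0" by simp
  then obtain x' y' where *: "dist x' x < e/3" "dist y' y < e/3" "joined_within V x' y' (c + e/3)"
    using assms relative_metric_le_iff by metis
  have "dist x y \<le> dist x' x + dist x' y' + dist y' y" 
    by (smt (verit) dist_commute dist_triangle)
  then show "dist x y \<le> c + e" using * joined_within_dist_le[OF *(3)] by linarith
qed

section \<open>Shortest connections that avoid the boundary are straight\<close>

lemma open_frontier_notin: "open V \<Longrightarrow> z \<in> frontier V \<Longrightarrow> z \<notin> V"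
  by (simp add: frontier_def interior_open)

text \<open>For a boundary point \<open>A\<close> and a point \<open>z\<close> of \<open>V\<close>, this says that the intrinsic distance from \<open>A\<close> to \<open>z\<close>,
as a lower limit over starting points in \<open>V\<close> that tend to \<open>A\<close>, is at most \<open>s\<close>. No triangle inequality
is available through the boundary point \<open>A\<close> itself: two points of \<open>V\<close> close to \<open>A\<close> may be far apart
along paths in \<open>V\<close>. All concatenations below are therefore made at points of \<open>V\<close>.\<close>

definition reach_from :: "'a::euclidean_space set \<Rightarrow> 'a \<Rightarrow> real \<Rightarrow> 'a \<Rightarrow> bool" where
  "reach_from V A s z \<longleftrightarrow> (\<forall>e>0. \<exists>x. dist x A < e \<and> joined_within V x z (s + e))"

definition reach_to :: "'a::euclidean_space set \<Rightarrow> 'a \<Rightarrow> real \<Rightarrow> 'a \<Rightarrow> bool" where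
  "reach_to V B s z \<longleftrightarrow> (\<forall>e>0. \<exists>y. dist y B < e \<and> joined_within V z y (s + e))"

lemma reach_fromE:
  assumes "reach_from V A s z" "e > 0"
  obtains x where "dist x A < e" "joined_within V x z (s + e)"
  using assms unfolding reach_from_def by blast

lemma reach_toE:
  assumes "reach_to V B s z" "e > 0"
  obtains y where "dist y B < e" "joined_within V z y (s + e)"
  using assms unfolding reach_to_def by blast

lemma reach_from_mem: "reach_from V A s z \<Longrightarrow> z \<in> V"
  using reach_fromE[of V A s z 1] joined_within_mem by (metis zero_less_one)

lemma reach_from_dist_le: assumes "reach_from V A s z" shows "dist A z \<le> s"
proof (rule field_le_epsilon)
  fix e :: real assume "e > 0"
  then obtain x where "dist x A < e/2" "joined_within V x z (s + e/2)"
    using reach_fromE[OF assms, of "e/2"] by auto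
  then show "dist A z \<le> s + e" using joined_within_dist_le[of V x z] dist_triangle3[of A z x] by fastforce
qed

lemma reach_to_dist_le: assumes "reach_to V B s z" shows "dist z B \<le> s"
proof (rule field_le_epsilon)
  fix e :: real assume "e > 0"
  then obtain x where "dist x B < e/2" "joined_within V z x (s + e/2)"
    using reach_toE[OF assms, of "e/2"] by auto
  then show "dist z B \<le> s + e" using joined_within_dist_le[of V z x] dist_triangle[of z B x] by fastforce
qed

lemma reach_from_step:
  assumes "reach_from V A s z" "joined_within V z z' t" shows "reach_from V A (s + t) z'"
  unfolding reach_from_def
proof (intro allI impI)
  fix e :: real assume "e > 0"
  then obtain x where "dist x A < e" "joined_within V x z (s + e)" using reach_fromE[OF assms(1)] by blast
  moreover from joined_within_trans[OF this(2) assms(2)] have "joined_within V x z' (s + t + e)"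
    by (simp add: algebra_simps)
  ultimately show "\<exists>x. dist x A < e \<and> joined_within V x z' (s + t + e)" by blast
qed

text \<open>Both steps must have length exactly \<open>d\<close>, and equality in the triangle inequality makes them parallel.\<close>

lemma equal_steps_collinear:
  fixes x y z :: "'a::real_inner"
  assumes "dist x y \<le> d" "dist y z \<le> d" "2 * d \<le> dist x z"
  shows "z - y = y - x"
proof -
  have d: "dist x y = d" "dist y z = d" "dist x z = 2 * d"
    using assms dist_triangle[of x z y] by linarith+
  have "norm ((y - x) + (z - y)) = norm (y - x) + norm (z - y)"
    using d by (simp add: dist_norm norm_minus_commute)
  then have "norm (y - x) *\<^sub>R (z - y) = norm (z - y) *\<^sub>R (y - x)"
    using norm_triangle_eq by blast
  then have "d *\<^sub>R (z - y) = d *\<^sub>R (y - x)" using d by (simp add: dist_norm norm_minus_commute)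
  moreover have "z = y \<and> y = x" if "d = 0" using d that by auto
  ultimately show ?thesis by (cases "d = 0") auto
qed

text \<open>Two boundary points at relative distance \<open>L\<close> such that no boundary point lies metrically between
them. Euclidean distance and relative distance then agree: a shortest connection has no boundary
point to bend around, hence is a segment. The argument
works with the sets \<open>level s\<close> of points at distance \<open>s\<close> from \<open>A\<close> and \<open>L - s\<close> from \<open>B\<close>, through which
every shortest curve would have to pass at time \<open>s\<close>.\<close>

locale nongrazing_pair =
  fixes V :: "'a::euclidean_space set" and A B :: 'a and L :: real
  assumes open_V: "open V" and L_pos: "L > 0"
    and A_frontier: "A \<in> frontier V" and B_frontier: "B \<in> frontier V"
    and distance: "relative_metric V A B = ennreal L"
    and nongrazing: "\<And>z s. z \<in> frontier V \<Longrightarrow> 0 < s \<Longrightarrow> s < L \<Longrightarrow>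
      relative_metric V A z \<le> ennreal s \<Longrightarrow> \<not> relative_metric V z B \<le> ennreal (L - s)"
begin

definition level :: "real \<Rightarrow> 'a set" where
  "level s = {z. reach_from V A s z \<and> reach_to V B (L - s) z}"

lemmas frontier_notin = open_frontier_notin[OF open_V]

lemma level_subset: "level s \<subseteq> V"
  unfolding level_def using reach_from_mem by blast

lemma distance_le_sum:
  assumes "reach_from V A s z" "reach_to V B t z" shows "L \<le> s + t"
proof -
  have st: "s + t \<ge> 0" using reach_from_dist_le[OF assms(1)] reach_to_dist_le[OF assms(2)]
    zero_le_dist[of A z] zero_le_dist[of z B] by linarith
  have "relative_metric V A B \<le> ennreal (s + t)"
  proof (rule relative_metric_le_iff[OF st frontier_notin[OF A_frontier] frontier_notin[OF B_frontier], THEN iffD2], intro allI impI)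
    fix e :: real assume "e > 0"
    then have "e/2 > 0" by simp
    obtain x where x: "dist x A < e/2" "joined_within V x z (s + e/2)"
      using reach_fromE[OF assms(1) \<open>e/2 > 0\<close>] .
    obtain y where y: "dist y B < e/2" "joined_within V z y (t + e/2)"
      using reach_toE[OF assms(2) \<open>e/2 > 0\<close>] .
    from joined_within_trans[OF x(2) y(2)] have "joined_within V x y (s + t + e)"
      by (rule joined_within_mono) simp
    then show "\<exists>x' y'. dist x' A < e \<and> dist y' B < e \<and> joined_within V x' y' (s + t + e)"
      using \<open>e > 0\<close> x(1) y(1) by (intro exI[of _ x] exI[of _ y]) auto
  qed
  then show ?thesis using distance st by (simp add: ennreal_le_iff)
qed

text \<open>The approximate version of \<open>level\<close>: a point on a path whose length exceeds \<open>L\<close> by little and whose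
ends are close to \<open>A\<close> and \<open>B\<close>, at arc length about \<open>s\<close>. Its limits are points of \<open>level\<close>.\<close>

definition near_level :: "real \<Rightarrow> real \<Rightarrow> 'a \<Rightarrow> bool" where
  "near_level s e z \<longleftrightarrow> (\<exists>x y. dist x A < e \<and> dist y B < e \<and>
    joined_within V x z (s + e) \<and> joined_within V z y (L - s + e))"

lemma near_level_mem: "near_level s e z \<Longrightarrow> z \<in> V"
  unfolding near_level_def using joined_within_mem by blast

lemma near_level_mono:
  assumes "near_level s e z" "e + \<bar>s - s'\<bar> \<le> e'" shows "near_level s' e' z"
proof -
  obtain x y where xy: "dist x A < e" "dist y B < e"
    "joined_within V x z (s + e)" "joined_within V z y (L - s + e)"
    using assms unfolding near_level_def by blast
  then show ?thesis unfolding near_level_def using assms(2)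
    by (intro exI[of _ x] exI[of _ y]) (auto intro: joined_within_mono[OF xy(3)] joined_within_mono[OF xy(4)])
qed

lemma level_imp_near_level:
  assumes "z \<in> level s" "e > 0" shows "near_level s e z"
  using assms unfolding level_def near_level_def reach_from_def reach_to_def by blast

text \<open>A limit of approximate level points lies in the closure of \<open>V\<close>. If it were on the frontier, it would
be a boundary point metrically between \<open>A\<close> and \<open>B\<close>. So it lies in \<open>V\<close>, where a small ball connects it
to the approximating points at no cost.\<close>

lemma level_closed:
  assumes s: "0 < s" "s < L"
    and approx: "\<And>e. e > 0 \<Longrightarrow> \<exists>z'. dist z' z < e \<and> near_level s e z'"
  shows "z \<in> level s"
proof -
  have "z \<in> closure V"
    unfolding closure_approachable using approx near_level_mem by blast
  have approx': "\<exists>x z' y. dist x A < e \<and> dist z' z < e \<and> dist y B < e \<and>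
    joined_within V x z' (s + e) \<and> joined_within V z' y (L - s + e)" if "e > 0" for e
    using approx[OF that] unfolding near_level_def by blast
  have "z \<in> V"
  proof (rule ccontr)
    assume "z \<notin> V"
    then have z: "z \<in> frontier V" using \<open>z \<in> closure V\<close> open_V by (simp add: frontier_def interior_open)
    have "0 \<le> s" "0 \<le> L - s" using s by auto
    have "relative_metric V A z \<le> ennreal s"
      by (rule relative_metric_le_iff[OF \<open>0 \<le> s\<close> frontier_notin[OF A_frontier] frontier_notin[OF z], THEN iffD2])
         (use approx' in blast)
    moreover have "relative_metric V z B \<le> ennreal (L - s)"
      by (rule relative_metric_le_iff[OF \<open>0 \<le> L - s\<close> frontier_notin[OF z] frontier_notin[OF B_frontier], THEN iffD2])
         (use approx' in blast)
    ultimately show False using nongrazing z s by blast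
  qed
  then obtain r where r: "r > 0" "ball z r \<subseteq> V" using open_V openE by blast
  have "\<exists>x y. dist x A < e \<and> dist y B < e \<and> joined_within V x z (s + e) \<and> joined_within V z y (L - s + e)"
    if "e > 0" for e
  proof -
    define d where "d = min (e/2) r"
    have d: "d > 0" "d \<le> e/2" "d \<le> r" "d \<le> e" using that r by (auto simp: d_def)
    obtain x z' y where z': "dist x A < d" "dist z' z < d" "dist y B < d"
      "joined_within V x z' (s + d)" "joined_within V z' y (L - s + d)"
      using approx'[OF d(1)] by blast
    have "closed_segment z z' \<subseteq> ball z r"
      using z' d r by (intro closed_segment_subset) (auto simp: dist_commute)
    then have "joined_within V z z' d" "joined_within V z' z d"
      using r z' joined_within_mono[OF joined_within_segment[of z z' V], of d]
        joined_within_mono[OF joined_within_segment[of z' z V], of d]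
      by (auto simp: closed_segment_commute dist_commute)
    then have xy: "joined_within V x z (s + d + d)" "joined_within V z y (d + (L - s + d))"
      using joined_within_trans z' by blast+
    then show ?thesis using d z' by (intro exI[of _ x] exI[of _ y]) (auto intro: joined_within_mono[OF xy(1)] joined_within_mono[OF xy(2)])
  qed
  then show ?thesis unfolding level_def reach_from_def reach_to_def by blast
qed

lemma near_level_limit:
  assumes s: "0 < s" "s < L" and bounded: "bounded (range z)"
    and approx: "\<And>n. near_level s (inverse (Suc n)) (z n)"
  obtains w k where "w \<in> level s" "strict_mono k" "(z \<circ> k) \<longlonglongrightarrow> w"
proof -
  obtain w k where k: "strict_mono k" "(z \<circ> k) \<longlonglongrightarrow> w"
    using bounded_imp_convergent_subsequence[OF bounded] by blast
  have "w \<in> level s"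
  proof (rule level_closed[OF s])
    fix e :: real assume "e > 0"
    then obtain N where N: "inverse (Suc N) < e" using reals_Archimedean by blast
    obtain M where M: "\<And>n. n \<ge> M \<Longrightarrow> dist (z (k n)) w < e"
      using metric_LIMSEQ_D[OF k(2) \<open>e > 0\<close>] by auto
    define n where "n = max M N"
    have "k n \<ge> N" using k(1) seq_suble[of k n] unfolding n_def by simp
    then have "inverse (real (Suc (k n))) \<le> inverse (Suc N)" by simp
    then have le: "inverse (real (Suc (k n))) \<le> e" using N by linarith
    show "\<exists>z'. dist z' w < e \<and> near_level s e z'"
      using M[of n] near_level_mono[OF approx[of "k n"], of s e] le
      by (intro exI[of _ "z (k n)"]) (auto simp: n_def)
  qed
  with k that show ?thesis by blast
qed

lemma near_level_dist:
  assumes "near_level s e z" shows "dist A z \<le> s + 2 * e"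
proof -
  obtain x where "dist x A < e" "joined_within V x z (s + e)"
    using assms unfolding near_level_def by blast
  then show ?thesis using joined_within_dist_le[of V x z] dist_triangle3[of A z x] by fastforce
qed

lemma level_dist: "z \<in> level s \<Longrightarrow> dist A z \<le> s" "z \<in> level s \<Longrightarrow> dist z B \<le> L - s"
  unfolding level_def using reach_from_dist_le reach_to_dist_le by blast+

lemma level_nonempty:
  assumes s: "0 < s" "s < L" obtains z where "z \<in> level s"
proof -
  have "\<exists>z. near_level s (inverse (Suc n)) z" for n
  proof -
    define e where "e = inverse (real (Suc n))"
    have e: "e > 0" unfolding e_def by simp
    have "0 \<le> L" "relative_metric V A B \<le> ennreal L" using L_pos distance by auto
    then obtain x y where xy: "dist x A < e" "dist y B < e" "joined_within V x y (L + e)"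
      using relative_metric_le_iff[of L A V B] frontier_notin A_frontier B_frontier e by metis
    obtain z where z: "joined_within V x z s" "joined_within V z y (L + e - s)"
      using joined_within_split[OF xy(3), of s] s e by auto
    then have "near_level s e z" unfolding near_level_def using xy e
      by (intro exI[of _ x] exI[of _ y]) (auto intro: joined_within_mono[OF z(1)] joined_within_mono[OF z(2)])
    then show ?thesis unfolding e_def by blast
  qed
  then obtain z where z: "\<And>n. near_level s (inverse (Suc n)) (z n)" by metis
  have "dist A (z n) \<le> s + 2" for n
    using near_level_dist[OF z[of n]] inverse_le_1_iff[of "real (Suc n)"] by (smt (verit) of_nat_Suc of_nat_0_le_iff)
  then have "bounded (range z)" unfolding bounded_def by blast
  from near_level_limit[OF s this z] that show ?thesis by blast
qed

lemma level_step:
  assumes z: "z \<in> level s" and s: "0 < s" and d: "0 < d" "s + d < L"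
  obtains z' where "z' \<in> level (s + d)" "dist z z' \<le> d"
proof -
  have "\<exists>z'. near_level (s + d) (inverse (Suc n)) z' \<and> dist z z' \<le> d" for n
  proof -
    define e where "e = inverse (real (Suc n))"
    have e: "e > 0" unfolding e_def by simp
    obtain x where x: "dist x A < e" "joined_within V x z (s + e)"
      using z e unfolding level_def reach_from_def by blast
    obtain y where y: "dist y B < e" "joined_within V z y (L - s + e)"
      using z e unfolding level_def reach_to_def by blast
    obtain z' where z': "joined_within V z z' d" "joined_within V z' y (L - s + e - d)"
      using joined_within_split[OF y(2), of d] d e by auto
    have xz': "joined_within V x z' (s + e + d)" using joined_within_trans[OF x(2) z'(1)] .
    have "near_level (s + d) e z'" unfolding near_level_def using x(1) y(1) e
      by (intro exI[of _ x] exI[of _ y]) (auto intro: joined_within_mono[OF xz'] joined_within_mono[OF z'(2)])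
    then show ?thesis using joined_within_dist_le[OF z'(1)] unfolding e_def by blast
  qed
  then obtain w where w: "\<And>n. near_level (s + d) (inverse (Suc n)) (w n)" "\<And>n. dist z (w n) \<le> d" by metis
  have "bounded (range w)" unfolding bounded_def using w(2) by blast
  moreover have "0 < s + d" using s d by simp
  ultimately obtain z' k where z': "z' \<in> level (s + d)" "(w \<circ> k) \<longlonglongrightarrow> z'"
    using near_level_limit[of "s + d" w] d(2) w(1) by blast
  have "dist z z' \<le> d"
    by (rule Lim_bounded[OF tendsto_dist[OF tendsto_const z'(2)]]) (use w(2) in auto)
  with z'(1) that show ?thesis by blast
qed

text \<open>The union of the levels over a compact range of parameters is compact and contained in \<open>V\<close>, so
its points have a common distance from the frontier.\<close>

lemma level_uniform_ball:
  assumes s: "0 < s0" "s1 < L"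
  obtains r where "r > 0" "\<And>s z. s0 \<le> s \<Longrightarrow> s \<le> s1 \<Longrightarrow> z \<in> level s \<Longrightarrow> ball z r \<subseteq> V"
proof -
  define K where "K = (\<Union>s\<in>{s0..s1}. level s)"
  have "compact K" unfolding compact_eq_bounded_closed
  proof
    have "dist A z \<le> L" if zK: "z \<in> K" for z
    proof -
      obtain s where "s \<le> s1" "z \<in> level s" using zK unfolding K_def by auto
      then show ?thesis using level_dist(1)[of z s] s by linarith
    qed
    then show "bounded K" unfolding bounded_def by blast
    show "closed K" unfolding closed_sequential_limits
    proof (intro allI impI, elim conjE)
      fix x l assume x: "\<forall>n. x n \<in> K" "x \<longlonglongrightarrow> l"
      then obtain s where s': "\<And>n. s n \<in> {s0..s1}" "\<And>n. x n \<in> level (s n)" 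
        unfolding K_def UN_iff Bex_def by metis
      obtain t k where t: "t \<in> {s0..s1}" "strict_mono k" "(s \<circ> k) \<longlonglongrightarrow> t"
        using s'(1) compact_Icc[of s0 s1] unfolding compact_def by metis
      have xk: "(x \<circ> k) \<longlonglongrightarrow> l" using LIMSEQ_subseq_LIMSEQ[OF x(2) t(2)] .
      have "l \<in> level t"
      proof (rule level_closed)
        show "0 < t" "t < L" using t s by auto
        fix e :: real assume e: "e > 0"
        have "\<forall>\<^sub>F n in sequentially. dist ((x \<circ> k) n) l < e \<and> dist ((s \<circ> k) n) t < e/2"
          using eventually_conj[OF tendstoD[OF xk e] tendstoD[OF t(3), of "e/2"]] e by simp
        then obtain n where "dist (x (k n)) l < e" "dist (s (k n)) t < e/2"
          unfolding eventually_sequentially o_def by blast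
        moreover from this have "near_level t e (x (k n))"
          using near_level_mono[OF level_imp_near_level[OF s'(2)[of "k n"], of "e/2"], of t e] e
          by (simp add: dist_real_def)
        ultimately show "\<exists>z'. dist z' l < e \<and> near_level t e z'" by blast
      qed
      then show "l \<in> K" using t unfolding K_def by blast
    qed
  qed
  moreover have "K \<subseteq> V" unfolding K_def using level_subset by blast
  ultimately obtain r where "r > 0" "(\<Union>x\<in>K. ball x r) \<subseteq> V"
    using open_V compact_subset_open_imp_ball_epsilon_subset by metis
  then show ?thesis using that[of r] unfolding K_def by fastforce
qed

text \<open>Otherwise the segment would be a shortcut that brings \<open>A\<close> and \<open>B\<close> closer together than \<open>L\<close>.\<close>

lemma levels_far_apart:
  assumes "z \<in> level s" "z' \<in> level s'" "closed_segment z z' \<subseteq> V"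
  shows "s' - s \<le> dist z z'"
proof -
  have "reach_from V A (s + dist z z') z'"
    using assms joined_within_segment reach_from_step unfolding level_def by blast
  then show ?thesis using distance_le_sum[of "s + dist z z'" z' "L - s'"] assms unfolding level_def by auto
qed

text \<open>Divide the parameter range into steps shorter than the uniform distance from the frontier and
choose successive level points. Each step has length at most \<open>d\<close>, while two consecutive steps stay
in a ball inside \<open>V\<close> and span at least \<open>2 * d\<close>. Hence consecutive steps are equal vectors and the chain
is straight.\<close>

lemma levels_straight:
  assumes s: "0 < s0" "s0 < s1" "s1 < L"
  obtains z z' where "z \<in> level s0" "z' \<in> level s1" "dist z z' = s1 - s0"
proof -
  obtain r where r: "r > 0" "\<And>s z. s0 \<le> s \<Longrightarrow> s \<le> s1 \<Longrightarrow> z \<in> level s \<Longrightarrow> ball z r \<subseteq> V"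
    using level_uniform_ball[OF s(1,3)] by blast
  obtain N where N: "real (Suc N) > (s1 - s0) / r" using reals_Archimedean2
    by (metis less_Suc_eq_le less_imp_of_nat_less order_less_trans lessI)
  define d where "d = (s1 - s0) / Suc N"
  have d: "d > 0" "d < r" "Suc N * d = s1 - s0"
    using s N r by (auto simp: d_def field_simps)
  let ?s = "\<lambda>k. s0 + real k * d"
  have below: "?s k \<le> s1" if "k \<le> Suc N" for k
    using that d mult_right_mono[of "real k" "real (Suc N)" d] by simp
  have "\<exists>z. \<forall>k. (k \<le> Suc N \<longrightarrow> z k \<in> level (?s k)) \<and> (k \<le> N \<longrightarrow> dist (z k) (z (Suc k)) \<le> d)"
  proof (rule dependent_nat_choice[where P = "\<lambda>k z. k \<le> Suc N \<longrightarrow> z \<in> level (?s k)"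
        and Q = "\<lambda>k z z'. k \<le> N \<longrightarrow> dist z z' \<le> d", THEN exE])
    show "\<exists>z. 0 \<le> Suc N \<longrightarrow> z \<in> level (?s 0)" using level_nonempty[of s0] s by auto
    show "\<exists>z'. (Suc k \<le> Suc N \<longrightarrow> z' \<in> level (?s (Suc k))) \<and> (k \<le> N \<longrightarrow> dist z z' \<le> d)"
      if zk: "k \<le> Suc N \<longrightarrow> z \<in> level (?s k)" for z k
    proof (cases "k \<le> N")
      case True
      have "0 < ?s k" using s d by (simp add: add_pos_nonneg)
      moreover have "?s k + d < L" using below[of "Suc k"] True s by (simp add: algebra_simps)
      ultimately obtain z' where "z' \<in> level (?s k + d)" "dist z z' \<le> d"
        using level_step[of z "?s k" d] zk True d by auto
      then show ?thesis by (intro exI[of _ z']) (simp add: algebra_simps)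
    qed simp
  qed blast
  then obtain z where z: "\<And>k. k \<le> Suc N \<Longrightarrow> z k \<in> level (?s k)" "\<And>k. k \<le> N \<Longrightarrow> dist (z k) (z (Suc k)) \<le> d"
    by blast
  have ball: "ball (z k) r \<subseteq> V" if "k \<le> Suc N" for k
    using r(2)[OF _ below[OF that] z(1)[OF that]] d by auto
  have same: "z (Suc (Suc k)) - z (Suc k) = z (Suc k) - z k" if k: "Suc k \<le> N" for k
  proof (rule equal_steps_collinear)
    show near: "dist (z k) (z (Suc k)) \<le> d" "dist (z (Suc k)) (z (Suc (Suc k))) \<le> d" using z k by auto
    have "closed_segment (z k) (z (Suc (Suc k))) \<subseteq> ball (z (Suc k)) r"
      using near d by (intro closed_segment_subset) (auto simp: dist_commute)
    then have "closed_segment (z k) (z (Suc (Suc k))) \<subseteq> V" using ball[of "Suc k"] k by auto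
    from levels_far_apart[OF z(1) z(1) this] k
    show "2 * d \<le> dist (z k) (z (Suc (Suc k)))" by (simp add: algebra_simps)
  qed
  define u where "u = z 1 - z 0"
  have step: "z (Suc k) - z k = u" if "k \<le> N" for k
    using that by (induction k) (auto simp: u_def same)
  have z_eq: "z k = z 0 + real k *\<^sub>R u" if "k \<le> Suc N" for k
    using that
  proof (induction k)
    case (Suc k)
    then have "z (Suc k) = z k + u" using step[of k] by (simp add: algebra_simps)
    then show ?case using Suc by (simp add: algebra_simps)
  qed simp
  have "closed_segment (z 0) (z 1) \<subseteq> ball (z 0) r"
    using z(2)[of 0] d by (intro closed_segment_subset) (auto simp: dist_commute)
  then have "closed_segment (z 0) (z 1) \<subseteq> V" using ball[of 0] by auto
  from levels_far_apart[OF z(1) z(1) this] z(2)[of 0] have "norm u = d"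
    by (simp add: u_def dist_norm norm_minus_commute)
  then have "dist (z 0) (z (Suc N)) = s1 - s0"
    using z_eq[of "Suc N"] d by (simp add: dist_norm)
  moreover have "?s (Suc N) = s1" using d by simp
  ultimately show ?thesis using that[of "z 0" "z (Suc N)"] z(1)[of 0] z(1)[of "Suc N"] by simp
qed

text \<open>Straightness is known between the levels \<open>s\<close> and \<open>L - s\<close>; these come within \<open>s\<close> of \<open>A\<close> and \<open>B\<close>, and
\<open>s\<close> is arbitrarily small.\<close>

theorem dist_eq: "dist A B = L"
proof (rule antisym)
  show "dist A B \<le> L"
    using relative_metric_imp_dist_le[of V A B L] distance L_pos frontier_notin A_frontier B_frontier by auto
  show "L \<le> dist A B"
  proof (rule field_le_epsilon)
    fix e :: real assume "e > 0"
    define s where "s = min (e/4) (L/4)"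
    have s: "0 < s" "s \<le> e/4" "s \<le> L/4" using \<open>e > 0\<close> L_pos by (auto simp: s_def)
    obtain z z' where z: "z \<in> level s" "z' \<in> level (L - s)" "dist z z' = L - s - s"
      using levels_straight[of s "L - s"] s L_pos by auto
    have "dist z z' \<le> dist A z + dist A B + dist z' B"
      by (smt (verit) dist_commute dist_triangle)
    moreover have "dist A z \<le> s" "dist z' B \<le> L - (L - s)" using level_dist z by blast+
    ultimately show "L \<le> dist A B + e" using z(3) s by linarith
  qed
qed

end

section \<open>Bijections from the plane onto a surface\<close>

text \<open>A bijective parametrisation need only be continuous: in a chart that flattens the surface,
invariance of domain makes it open. This is what allows a surface point that is close to a
given one to be traced back to a nearby parameter.\<close>

lemma bijection_onto_C1_surface_open:
  fixes g :: "real \<times> real \<Rightarrow> 'a::euclidean_space"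
  assumes M: "C1_submanifold 2 M" and g: "continuous_on UNIV g" "inj g" "range g = M"
    and r: "r > 0"
  obtains r' where "r' > 0" "M \<inter> ball (g w) r' \<subseteq> g ` ball w r"
proof -
  have "g w \<in> M" using g by blast
  then obtain W W' \<phi> \<psi> and S :: "'a set" where W: "g w \<in> W" "C1_diffeomorphism W W' \<phi> \<psi>"
    "subspace S" "dim S = 2" "\<phi> ` (M \<inter> W) = S \<inter> W'"
    using M unfolding C1_submanifold_def by metis
  have oW: "open W" and hom: "homeomorphism W W' \<phi> \<psi>" using W(2) unfolding C1_diffeomorphism_def by auto
  have c\<phi>: "continuous_on W \<phi>" and inj\<phi>: "inj_on \<phi> W"
    using hom unfolding homeomorphism_def by (auto intro: inj_on_inverseI)
  define Q where "Q = ball w r \<inter> g -` W"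
  have oQ: "open Q" unfolding Q_def using open_vimage[OF oW g(1)] by (intro open_Int) auto
  have gQ: "g ` Q \<subseteq> M \<inter> W" using g unfolding Q_def by auto
  have "openin (top_of_set S) ((\<phi> \<circ> g) ` Q)"
  proof (rule invariance_of_domain_subspaces)
    show "openin (top_of_set UNIV) Q" using oQ by simp
    show "subspace (UNIV :: (real \<times> real) set)" "subspace S" using W by auto
    show "dim S \<le> dim (UNIV :: (real \<times> real) set)" using W by simp
    show "continuous_on Q (\<phi> \<circ> g)"
      using gQ by (intro continuous_on_compose continuous_on_subset[OF g(1)] continuous_on_subset[OF c\<phi>]) auto
    show "\<phi> \<circ> g \<in> Q \<rightarrow> S" using gQ W(5) by fastforce
    show "inj_on (\<phi> \<circ> g) Q"
      using gQ by (intro comp_inj_on inj_on_subset[OF g(2)] inj_on_subset[OF inj\<phi>]) auto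
  qed
  then obtain T where T: "open T" "(\<phi> \<circ> g) ` Q = S \<inter> T" unfolding openin_open by blast
  have "open (W \<inter> \<phi> -` T)" using continuous_open_preimage[OF c\<phi> oW T(1)] .
  moreover have "g w \<in> W \<inter> \<phi> -` T" using T(2) W(1) r unfolding Q_def by fastforce
  ultimately obtain r' where r': "r' > 0" "ball (g w) r' \<subseteq> W \<inter> \<phi> -` T" using openE by blast
  have "z \<in> g ` ball w r" if z: "z \<in> M" "z \<in> ball (g w) r'" for z
  proof -
    have zW: "z \<in> W" "\<phi> z \<in> T" using r' z by auto
    then have "\<phi> z \<in> S \<inter> T" using W(5) z by blast
    then obtain q where q: "q \<in> Q" "\<phi> z = \<phi> (g q)" using T(2) by (metis imageE o_apply)
    then have "z = g q" using inj_onD[OF inj\<phi> q(2)] zW gQ by blast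
    then show ?thesis using q unfolding Q_def by blast
  qed
  then show ?thesis using that r'(1) by blast
qed

section \<open>The saddle surface and its two sides\<close>

definition saddle :: "real \<times> real \<Rightarrow> real ^ 3" where
  "saddle w = vector [fst w, snd w, fst w * snd w]"

definition above_saddle :: "(real ^ 3) set" where
  "above_saddle = {x. x $ 1 * x $ 2 < x $ 3}"

definition below_saddle :: "(real ^ 3) set" where
  "below_saddle = {x. x $ 3 < x $ 1 * x $ 2}"

lemma saddle_nth [simp]:
  "saddle w $ 1 = fst w" "saddle w $ 2 = snd w" "saddle w $ 3 = fst w * snd w"
  by (simp_all add: saddle_def vector_3)

lemma axis_nth_3 [simp]:
  "axis 1 (c::real) $ (1::3) = c" "axis 1 c $ (2::3) = 0" "axis 1 c $ (3::3) = 0"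
  "axis 2 c $ (1::3) = 0" "axis 2 c $ (2::3) = c" "axis 2 c $ (3::3) = 0"
  "axis 3 c $ (1::3) = 0" "axis 3 c $ (2::3) = 0" "axis 3 c $ (3::3) = c"
  by (simp_all add: axis_def)

lemma saddle_eq: "saddle w = fst w *\<^sub>R axis 1 1 + snd w *\<^sub>R axis 2 1 + (fst w * snd w) *\<^sub>R axis 3 1"
  by (simp add: vec_eq_iff forall_3)

lemma continuous_saddle: "continuous_on S saddle"
  unfolding saddle_eq by (intro continuous_intros)

lemma inj_saddle: "inj saddle"
  by (rule injI) (metis prod_eq_iff saddle_nth(1,2))

lemma range_saddle: "range saddle = {x. x $ 3 = x $ 1 * x $ 2}"
proof -
  have "x = saddle (x $ 1, x $ 2)" if "x $ 3 = x $ 1 * x $ 2" for x :: "real ^ 3"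
    using that by (simp add: vec_eq_iff forall_3)
  then show ?thesis by auto
qed

lemma open_above_saddle: "open above_saddle"
  unfolding above_saddle_def by (intro open_Collect_less continuous_intros)

lemma open_below_saddle: "open below_saddle"
  unfolding below_saddle_def by (intro open_Collect_less continuous_intros)

text \<open>Adding a multiple of \<open>x y\<close> to the third coordinate turns the horizontal plane into the saddle and
back.\<close>

definition shear :: "real \<Rightarrow> real ^ 3 \<Rightarrow> real ^ 3" where
  "shear c x = x + (c * (x $ 1 * x $ 2)) *\<^sub>R axis 3 1"

lemma shear_nth [simp]:
  "shear c x $ 1 = x $ 1" "shear c x $ 2 = x $ 2" "shear c x $ 3 = x $ 3 + c * (x $ 1 * x $ 2)"
  by (simp_all add: shear_def)

lemma shear_inverse: "shear (-c) (shear c x) = x"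
  by (simp add: vec_eq_iff forall_3)

lemma continuous_shear: "continuous_on S (shear c)"
  unfolding shear_def by (intro continuous_intros)

lemma C1_shear: "C1_map_on (shear c) UNIV"
proof -
  define E :: "3 \<Rightarrow> (real ^ 3) \<Rightarrow>\<^sub>L (real ^ 3)" where "E = (\<lambda>i. Blinfun (\<lambda>h. (h $ i) *\<^sub>R axis 3 1))"
  have bl: "bounded_linear (\<lambda>h::real^3. (h $ i) *\<^sub>R (axis 3 1 :: real ^ 3))" for i
    using bounded_linear_scaleR_const[OF bounded_linear_vec_nth] .
  have E: "blinfun_apply (E i) h = (h $ i) *\<^sub>R axis 3 1" for i h
    unfolding E_def by (simp add: bounded_linear_Blinfun_apply[OF bl])
  define D where "D = (\<lambda>x::real^3. id_blinfun + (c * x $ 1) *\<^sub>R E 2 + (c * x $ 2) *\<^sub>R E 1)"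
  have "(shear c has_derivative blinfun_apply (D x)) (at x)" for x
  proof -
    have "(shear c has_derivative (\<lambda>h. h + (c * (x $ 1 * h $ 2 + h $ 1 * x $ 2)) *\<^sub>R axis 3 1)) (at x)"
      unfolding shear_def
      by (rule derivative_eq_intros bounded_linear.has_derivative[OF bounded_linear_vec_nth] refl | simp)+
    moreover have "(\<lambda>h. h + (c * (x $ 1 * h $ 2 + h $ 1 * x $ 2)) *\<^sub>R axis 3 1) = blinfun_apply (D x)"
      by (rule ext) (simp add: D_def blinfun.add_left blinfun.scaleR_left E algebra_simps)
    ultimately show ?thesis by simp
  qed
  moreover have "continuous_on UNIV D" unfolding D_def by (intro continuous_intros)
  ultimately show ?thesis unfolding C1_map_on_def by blast
qed

lemma shear_diffeomorphism: "C1_diffeomorphism UNIV UNIV (shear (-1)) (shear 1)"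
proof -
  have "homeomorphism UNIV UNIV (shear (-1)) (shear 1)"
    using shear_inverse[of 1] shear_inverse[of "-1"] continuous_shear
    by (intro homeomorphismI) auto
  then show ?thesis unfolding C1_diffeomorphism_def using C1_shear by auto
qed

lemma connected_above_saddle: "connected above_saddle"
proof -
  have "above_saddle = shear 1 ` {x. x $ 3 > 0}"
  proof (intro equalityI subsetI)
    fix x assume "x \<in> above_saddle"
    then have "x = shear 1 (shear (-1) x)" "shear (-1) x \<in> {x. x $ 3 > 0}"
      using shear_inverse[of "-1" x] by (auto simp: above_saddle_def)
    then show "x \<in> shear 1 ` {x. x $ 3 > 0}" by blast
  qed (auto simp: above_saddle_def)
  moreover have "convex {x::real^3. x $ 3 > 0}" 
    using convex_halfspace_gt[of 0 "axis 3 1 :: real ^ 3"] by (simp add: inner_axis')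
  ultimately show ?thesis
    using connected_continuous_image[OF continuous_shear convex_connected] by metis
qed

text \<open>The half-turn about the second coordinate axis. It preserves the saddle and exchanges its sides.\<close>

definition flip :: "real ^ 3 \<Rightarrow> real ^ 3" where
  "flip x = vector [- (x $ 1), x $ 2, - (x $ 3)]"

lemma flip_nth [simp]: "flip x $ 1 = - (x $ 1)" "flip x $ 2 = x $ 2" "flip x $ 3 = - (x $ 3)"
  by (simp_all add: flip_def vector_3)

lemma norm_3: "norm (x :: real ^ 3) = sqrt ((x $ 1)\<^sup>2 + (x $ 2)\<^sup>2 + (x $ 3)\<^sup>2)"
  by (simp add: norm_eq_sqrt_inner inner_vec_def sum_3 power2_eq_square)

lemma dist_flip: "dist (flip x) (flip y) = dist x y"
proof -
  have "(- a + b)\<^sup>2 = (a - b)\<^sup>2" for a b :: real by algebra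
  then show ?thesis by (simp add: dist_norm norm_3)
qed

lemma flip_above_saddle: "flip ` above_saddle = below_saddle"
proof (intro equalityI subsetI)
  fix x assume "x \<in> below_saddle"
  then have "x = flip (flip x)" "flip x \<in> above_saddle"
    by (auto simp: above_saddle_def below_saddle_def vec_eq_iff forall_3)
  then show "x \<in> flip ` above_saddle" by blast
qed (auto simp: above_saddle_def below_saddle_def)

lemma connected_below_saddle: "connected below_saddle"
proof -
  have "continuous_on above_saddle flip"
    unfolding continuous_on_iff using dist_flip by metis
  then show ?thesis
    using connected_continuous_image connected_above_saddle flip_above_saddle by metis
qed

text \<open>Along a chord of the saddle the height above the saddle is \<open>t (1 - t) (u' - u) (v' - v)\<close>. So
chords between parameters that are comparable in the product order run above the saddle, and
chords between incomparable ones below it. Lifting by \<open>h\<close> takes care of the comparable chords that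
lie in the surface, the rulings.\<close>

lemma lift_in_above_saddle:
  assumes "h > 0" "(fst w' - fst w) * (snd w' - snd w) \<ge> 0"
  shows "closed_segment (saddle w + h *\<^sub>R axis 3 1) (saddle w' + h *\<^sub>R axis 3 1) \<subseteq> above_saddle"
proof
  fix x assume "x \<in> closed_segment (saddle w + h *\<^sub>R axis 3 1) (saddle w' + h *\<^sub>R axis 3 1)"
  then obtain t where t: "0 \<le> t" "t \<le> 1"
    "x = (1 - t) *\<^sub>R (saddle w + h *\<^sub>R axis 3 1) + t *\<^sub>R (saddle w' + h *\<^sub>R axis 3 1)"
    unfolding in_segment by blast
  have "x $ 3 - x $ 1 * x $ 2 = h + (t * (1 - t)) * ((fst w' - fst w) * (snd w' - snd w))"
    unfolding t(3) by (simp add: algebra_simps)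
  moreover have "(t * (1 - t)) * ((fst w' - fst w) * (snd w' - snd w)) \<ge> 0"
    using t assms by (intro mult_nonneg_nonneg[OF _ assms(2)]) auto
  ultimately show "x \<in> above_saddle" using assms unfolding above_saddle_def by simp
qed

lemma open_chord_in_above_saddle:
  assumes "(fst w' - fst w) * (snd w' - snd w) > 0"
  shows "open_segment (saddle w) (saddle w') \<subseteq> above_saddle"
proof
  fix x assume "x \<in> open_segment (saddle w) (saddle w')"
  then obtain t where t: "0 < t" "t < 1" "x = (1 - t) *\<^sub>R saddle w + t *\<^sub>R saddle w'"
    unfolding in_segment by blast
  have "x $ 3 - x $ 1 * x $ 2 = (t * (1 - t)) * ((fst w' - fst w) * (snd w' - snd w))"
    unfolding t(3) by (simp add: algebra_simps)
  moreover have "(t * (1 - t)) * ((fst w' - fst w) * (snd w' - snd w)) > 0"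
    using t assms by simp
  ultimately show "x \<in> above_saddle" unfolding above_saddle_def by simp
qed

lemma saddle_notin_above: "saddle w \<notin> above_saddle"
  by (simp add: above_saddle_def)

lemma frontier_above_saddle: "frontier above_saddle = range saddle"
proof (intro equalityI subsetI)
  fix x assume x: "x \<in> frontier above_saddle"
  have "closed {x::real^3. x $ 1 * x $ 2 \<le> x $ 3}" by (intro closed_Collect_le continuous_intros)
  moreover have "above_saddle \<subseteq> {x. x $ 1 * x $ 2 \<le> x $ 3}" unfolding above_saddle_def by auto
  ultimately have "closure above_saddle \<subseteq> {x. x $ 1 * x $ 2 \<le> x $ 3}" by (simp add: closure_minimal)
  then show "x \<in> range saddle"
    using x open_above_saddle unfolding range_saddle frontier_def
    by (auto simp: interior_open above_saddle_def)
next
  fix x assume "x \<in> range saddle"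
  then obtain w where w: "x = saddle w" by blast
  have "x \<in> closure above_saddle" unfolding closure_approachable
  proof (intro allI impI)
    fix e :: real assume e: "e > 0"
    have "saddle w + (e/2) *\<^sub>R axis 3 1 \<in> above_saddle"
      using e by (simp add: above_saddle_def)
    moreover have "dist (saddle w + (e/2) *\<^sub>R axis 3 1) x < e"
      using e w by (simp add: dist_norm)
    ultimately show "\<exists>y\<in>above_saddle. dist y x < e" by blast
  qed
  then show "x \<in> frontier above_saddle"
    using saddle_notin_above w open_above_saddle by (simp add: frontier_def interior_open)
qed

lemma smooth_boundary_above_saddle: "smooth_boundary above_saddle"
  unfolding smooth_boundary_def C1_submanifold_def frontier_above_saddle
proof
  fix p assume "p \<in> range saddle"
  define S :: "(real ^ 3) set" where "S = {x. axis 3 1 \<bullet> x = 0}"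
  have S: "S = {x. x $ 3 = 0}" unfolding S_def by (simp add: inner_axis')
  have "shear (-1) ` range saddle = S"
  proof (intro equalityI subsetI)
    fix x assume "x \<in> S"
    then have "x = shear (-1) (shear 1 x)" "shear 1 x \<in> range saddle"
      using shear_inverse[of 1 x] by (auto simp: range_saddle S)
    then show "x \<in> shear (-1) ` range saddle" by blast
  qed (auto simp: S)
  then have "\<exists>S'. subspace S' \<and> dim S' = DIM(real ^ 3) - 1 \<and> shear (-1) ` (range saddle \<inter> UNIV) = S' \<inter> UNIV"
    using subspace_hyperplane[of "axis 3 1 :: real ^ 3"] dim_hyperplane[of "axis 3 1 :: real ^ 3"]
    by (intro exI[of _ S]) (simp add: S_def axis_eq_0_iff)
  then show "\<exists>W W' \<phi> \<psi> (S :: (real ^ 3) set). p \<in> W \<and> C1_diffeomorphism W W' \<phi> \<psi> \<and> subspace S \<and>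
      dim S = DIM(real ^ 3) - 1 \<and> \<phi> ` (range saddle \<inter> W) = S \<inter> W'"
    using shear_diffeomorphism by blast
qed

text \<open>The midpoint of a chord between incomparable parameters lies below the saddle, and so does that of
a slight lift of it.\<close>

lemma above_saddle_not_convex: "\<not> convex above_saddle"
proof
  assume c: "convex above_saddle"
  define a b :: "real ^ 3" where "a = vector [1, -1, -1/2]" and "b = vector [-1, 1, -1/2]"
  have "a \<in> above_saddle" "b \<in> above_saddle" by (auto simp: a_def b_def above_saddle_def vector_3)
  then have "(1/2) *\<^sub>R a + (1/2) *\<^sub>R b \<in> above_saddle" using c by (intro convexD) auto
  then show False by (auto simp: a_def b_def above_saddle_def vector_3)
qed

lemma relative_metric_saddle_le:
  assumes "0 \<le> c"
    and "\<And>h. h > 0 \<Longrightarrow> joined_within above_saddle (saddle w + h *\<^sub>R axis 3 1) (saddle w' + h *\<^sub>R axis 3 1) c"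
  shows "relative_metric above_saddle (saddle w) (saddle w') \<le> ennreal c"
proof (rule relative_metric_le_iff[OF assms(1) saddle_notin_above saddle_notin_above, THEN iffD2], intro allI impI)
  fix e :: real assume e: "e > 0"
  show "\<exists>x' y'. dist x' (saddle w) < e \<and> dist y' (saddle w') < e \<and> joined_within above_saddle x' y' (c + e)"
    using e assms(2)[of "e/2"]
    by (intro exI[of _ "saddle w + (e/2) *\<^sub>R axis 3 1"] exI[of _ "saddle w' + (e/2) *\<^sub>R axis 3 1"])
       (auto simp: dist_norm intro: joined_within_mono)
qed

lemma relative_metric_saddle_chord:
  assumes "(fst w' - fst w) * (snd w' - snd w) \<ge> 0"
  shows "relative_metric above_saddle (saddle w) (saddle w') = ennreal (dist (saddle w) (saddle w'))"
proof (rule antisym)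
  show "relative_metric above_saddle (saddle w) (saddle w') \<le> ennreal (dist (saddle w) (saddle w'))"
    using joined_within_segment[OF lift_in_above_saddle[OF _ assms]]
    by (intro relative_metric_saddle_le) auto
  show "ennreal (dist (saddle w) (saddle w')) \<le> relative_metric above_saddle (saddle w) (saddle w')"
  proof (rule ccontr)
    assume "\<not> ?thesis"
    then have lt: "relative_metric above_saddle (saddle w) (saddle w') < ennreal (dist (saddle w) (saddle w'))" by simp
    then obtain c where c: "relative_metric above_saddle (saddle w) (saddle w') = ennreal c" "0 \<le> c"
      by (metis ennreal_cases ennreal_less_top order.strict_trans top.not_eq_extremum)
    then have "dist (saddle w) (saddle w') \<le> c"
      using relative_metric_imp_dist_le[OF _ _ saddle_notin_above saddle_notin_above] by simp
    with lt c show False by (metis ennreal_leI not_le)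
  qed
qed

text \<open>Any two points of the saddle are joined by two rulings, so relative distances on the saddle tend to
zero together with Euclidean ones.\<close>

lemma relative_metric_saddle_corner:
  "relative_metric above_saddle (saddle w) (saddle w')
    \<le> ennreal (dist (saddle w) (saddle (fst w', snd w)) + dist (saddle (fst w', snd w)) (saddle w'))"
proof (rule relative_metric_saddle_le)
  fix h :: real assume h: "h > 0"
  let ?l = "\<lambda>w. saddle w + h *\<^sub>R axis 3 1"
  have "joined_within above_saddle (?l w) (?l (fst w', snd w)) (dist (?l w) (?l (fst w', snd w)))"
    "joined_within above_saddle (?l (fst w', snd w)) (?l w') (dist (?l (fst w', snd w)) (?l w'))"
    by (rule joined_within_segment, rule lift_in_above_saddle; use h in simp)+
  from joined_within_trans[OF this]
  show "joined_within above_saddle (?l w) (?l w')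
    (dist (saddle w) (saddle (fst w', snd w)) + dist (saddle (fst w', snd w)) (saddle w'))"
    by simp
qed simp

lemma relative_metric_saddle_small:
  assumes "e > 0"
  obtains r where "r > 0"
    "\<And>w'. w' \<in> ball w r \<Longrightarrow> relative_metric above_saddle (saddle w') (saddle w) < ennreal e"
proof -
  let ?d = "\<lambda>w'. dist (saddle w') (saddle (fst w, snd w')) + dist (saddle (fst w, snd w')) (saddle w)"
  have "continuous_on UNIV ?d"
    unfolding saddle_eq by (intro continuous_intros)
  then have "(?d \<longlongrightarrow> ?d w) (at w)" unfolding continuous_on_def by blast
  then have "\<forall>\<^sub>F w' in at w. ?d w' < e" using assms by (intro order_tendstoD) auto
  then obtain r where r: "r > 0" "\<And>w'. w' \<noteq> w \<Longrightarrow> dist w' w < r \<Longrightarrow> ?d w' < e"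
    unfolding eventually_at by blast
  show ?thesis
  proof (rule that[OF r(1)])
    fix w' assume "w' \<in> ball w r"
    then have "?d w' < e" using r(2)[of w'] assms by (cases "w' = w") (auto simp: dist_commute)
    then have "ennreal (?d w') < ennreal e" using assms by (intro ennreal_lessI) auto
    then show "relative_metric above_saddle (saddle w') (saddle w) < ennreal e"
      using relative_metric_saddle_corner[of w' w] by order
  qed
qed

section \<open>Transport of visible chords by a local isometry\<close>

text \<open>Only \<open>f\<close> is known to be locally isometric, not its inverse. Continuity of \<open>f\<close> on the saddle is
immediate from this; control of the inverse comes from invariance of domain.\<close>

locale saddle_boundary_isometry =
  fixes V :: "(real ^ 3) set" and f :: "real ^ 3 \<Rightarrow> real ^ 3"
  assumes open_V: "open V" and surface: "C1_submanifold 2 (frontier V)"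
    and bij: "bij_betw f (range saddle) (frontier V)"
    and isometric: "\<forall>y\<in>range saddle. \<exists>\<epsilon>::real. \<epsilon> > 0 \<and>
      (\<forall>a\<in>{z \<in> range saddle. relative_metric above_saddle z y < ennreal \<epsilon>}.
       \<forall>b\<in>{z \<in> range saddle. relative_metric above_saddle z y < ennreal \<epsilon>}.
        relative_metric above_saddle a b = relative_metric V (f a) (f b))"
begin

definition g :: "real \<times> real \<Rightarrow> real ^ 3" where "g w = f (saddle w)"

lemma range_g: "range g = frontier V"
  using bij unfolding g_def bij_betw_def by auto

lemma inj_g: "inj g"
proof -
  have "inj (f \<circ> saddle)" using bij inj_saddle by (intro comp_inj_on) (auto simp: bij_betw_def)
  then show ?thesis by (simp add: g_def inj_def)
qed

lemma g_frontier: "g w \<in> frontier V"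
  using range_g by blast

lemmas frontier_notin = open_frontier_notin[OF open_V]

text \<open>Balls of the relative metric on the saddle contain images of parameter balls, so the local
isometry can be used on parameter balls.\<close>

lemma relative_metric_g:
  obtains r where "r > 0" "\<And>w w'. w \<in> ball w0 r \<Longrightarrow> w' \<in> ball w0 r \<Longrightarrow>
    relative_metric V (g w) (g w') = relative_metric above_saddle (saddle w) (saddle w')"
proof -
  obtain \<epsilon> :: real where \<epsilon>: "\<epsilon> > 0"
    "\<And>a b. a \<in> range saddle \<Longrightarrow> relative_metric above_saddle a (saddle w0) < ennreal \<epsilon> \<Longrightarrow>
      b \<in> range saddle \<Longrightarrow> relative_metric above_saddle b (saddle w0) < ennreal \<epsilon> \<Longrightarrow>
      relative_metric above_saddle a b = relative_metric V (f a) (f b)"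
    using isometric by blast
  obtain r where r: "r > 0"
    "\<And>w. w \<in> ball w0 r \<Longrightarrow> relative_metric above_saddle (saddle w) (saddle w0) < ennreal \<epsilon>"
    using relative_metric_saddle_small[OF \<epsilon>(1), of w0] by blast
  show ?thesis
    using that[OF r(1)] \<epsilon>(2)[OF rangeI r(2) rangeI r(2)] unfolding g_def by metis
qed

lemma continuous_g: "continuous_on S g"
proof -
  have "\<exists>d>0. \<forall>w. dist w w0 < d \<longrightarrow> dist (g w) (g w0) \<le> e" if e: "e > 0" for w0 and e :: real
  proof -
    obtain r where r: "r > 0" "\<And>w w'. w \<in> ball w0 r \<Longrightarrow> w' \<in> ball w0 r \<Longrightarrow>
      relative_metric V (g w) (g w') = relative_metric above_saddle (saddle w) (saddle w')"
      using relative_metric_g[of w0] by blast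
    obtain r' where r': "r' > 0"
      "\<And>w. w \<in> ball w0 r' \<Longrightarrow> relative_metric above_saddle (saddle w) (saddle w0) < ennreal e"
      using relative_metric_saddle_small[OF e, of w0] by blast
    have "dist (g w) (g w0) \<le> e" if "dist w w0 < min r r'" for w
    proof (rule relative_metric_imp_dist_le)
      show "relative_metric V (g w) (g w0) \<le> ennreal e"
        using r(2)[of w w0] r'(2)[of w] that r(1) by (simp add: dist_commute)
    qed (use e g_frontier frontier_notin in auto)
    then show ?thesis using r(1) r'(1) by (intro exI[of _ "min r r'"]) auto
  qed
  then have "\<exists>d>0. \<forall>w. dist w w0 < d \<longrightarrow> dist (g w) (g w0) < e" if "e > 0" for w0 and e :: real
    using that by (metis half_gt_zero field_less_half_sum le_less_trans field_sum_of_halves less_add_same_cancel1)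
  then show ?thesis unfolding continuous_on_iff by meson
qed

text \<open>A chord that runs inside the region above the saddle keeps its length. A boundary point of \<open>V\<close>
metrically between the images of its ends is close to them, hence the image of a nearby point of
the saddle; the isometry places that point on the open chord, which contains no point of the saddle.
So the images of the ends have no boundary point between them, and their Euclidean distance
equals their relative distance.\<close>

lemma visible_chord_length:
  obtains r where "r > 0" "\<And>w w'. w \<in> ball w0 r \<Longrightarrow> w' \<in> ball w0 r \<Longrightarrow>
    (fst w' - fst w) * (snd w' - snd w) > 0 \<Longrightarrow> dist (g w) (g w') = dist (saddle w) (saddle w')"
proof -
  obtain r where r: "r > 0" "\<And>w w'. w \<in> ball w0 r \<Longrightarrow> w' \<in> ball w0 r \<Longrightarrow>
    relative_metric V (g w) (g w') = relative_metric above_saddle (saddle w) (saddle w')"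
    using relative_metric_g[of w0] by blast
  obtain R where R: "R > 0" "frontier V \<inter> ball (g w0) R \<subseteq> g ` ball w0 r"
    using bijection_onto_C1_surface_open[OF surface continuous_g inj_g range_g r(1)] by blast
  obtain d1 where d1: "d1 > 0" "\<And>w. dist w w0 < d1 \<Longrightarrow> dist (g w) (g w0) < R/2"
    using continuous_g[of UNIV] R(1) unfolding continuous_on_iff by (metis UNIV_I half_gt_zero)
  obtain d2 where d2: "d2 > 0" "\<And>w. dist w w0 < d2 \<Longrightarrow> dist (saddle w) (saddle w0) < R/4"
    using continuous_saddle[of UNIV] R(1) unfolding continuous_on_iff
    by (metis UNIV_I zero_less_divide_iff zero_less_numeral)
  define d where "d = min r (min d1 d2)"
  have d: "d > 0" "d \<le> r" "d \<le> d1" "d \<le> d2" using r d1 d2 by (auto simp: d_def)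
  show ?thesis
  proof (rule that[OF d(1)])
    fix w w' assume ww': "w \<in> ball w0 d" "w' \<in> ball w0 d" and vis: "(fst w' - fst w) * (snd w' - snd w) > 0"
    \<comment> \<open>\<open>L\<close> is below \<open>R/2\<close> and \<open>g w\<close> within \<open>R/2\<close> of \<open>g w0\<close>, so points within \<open>L\<close> of \<open>g w\<close> are in \<open>ball (g w0) R\<close>.\<close>
    define L where "L = dist (saddle w) (saddle w')"
    have wr: "w \<in> ball w0 r" "w' \<in> ball w0 r" using ww' d by auto
    have "dist (saddle w) (saddle w0) < R/4" "dist (saddle w') (saddle w0) < R/4"
      using d2(2)[of w] d2(2)[of w'] ww' d by (auto simp: dist_commute)
    then have LR: "L < R/2" unfolding L_def using dist_triangle2[of "saddle w" "saddle w'" "saddle w0"] by linarith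
    have wR: "dist (g w) (g w0) < R/2" using d1(2)[of w] ww' d by (auto simp: dist_commute)
    have "saddle w \<noteq> saddle w'" using vis inj_saddle by (auto dest: injD)
    interpret nongrazing_pair V "g w" "g w'" L
    proof
      show "open V" "g w \<in> frontier V" "g w' \<in> frontier V" using open_V g_frontier by auto
      show "L > 0" using \<open>saddle w \<noteq> saddle w'\<close> by (simp add: L_def)
      show "relative_metric V (g w) (g w') = ennreal L"
        using r(2)[OF wr] relative_metric_saddle_chord[of w' w] vis unfolding L_def by simp
      fix z s assume z: "z \<in> frontier V" and s: "0 < s" "s < L" and le: "relative_metric V (g w) z \<le> ennreal s"
      show "\<not> relative_metric V z (g w') \<le> ennreal (L - s)"
      proof
        assume le': "relative_metric V z (g w') \<le> ennreal (L - s)"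
        have "dist (g w) z \<le> s"
          using relative_metric_imp_dist_le[OF le] s frontier_notin g_frontier z by auto
        then have "dist (g w0) z < R" using s LR wR dist_triangle3[of "g w0" z "g w"] by linarith
        then have "z \<in> g ` ball w0 r" using R(2) z by auto
        then obtain c where c: "c \<in> ball w0 r" "z = g c" by blast
        have "dist (saddle w) (saddle c) \<le> s" "dist (saddle c) (saddle w') \<le> L - s"
          using le le' c r(2)[OF wr(1) c(1)] r(2)[OF c(1) wr(2)] s
          by (auto intro!: relative_metric_imp_dist_le[OF _ _ saddle_notin_above saddle_notin_above])
        then have "dist (saddle w) (saddle c) = s" "dist (saddle c) (saddle w') = L - s"
          using dist_triangle[of "saddle w" "saddle w'" "saddle c"] unfolding L_def by linarith+
        then have "saddle c \<in> open_segment (saddle w) (saddle w')"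
          using s unfolding open_segment_def L_def by (auto simp: between between_mem_segment[symmetric])
        then show False using open_chord_in_above_saddle[OF vis] saddle_notin_above by blast
      qed
    qed
    show "dist (g w) (g w') = dist (saddle w) (saddle w')" using dist_eq unfolding L_def .
  qed
qed

end

section \<open>Rigidity of the saddle\<close>

text \<open>Equality in the triangle inequality forces the image of every intermediate parameter onto the
chord between the images of the end parameters.\<close>

lemma constant_speed_affine:
  fixes h :: "real \<Rightarrow> 'a::real_inner"
  assumes d: "d > 0" and c: "c > 0"
    and dist: "\<And>s t. \<bar>s\<bar> \<le> d \<Longrightarrow> \<bar>t\<bar> \<le> d \<Longrightarrow> s \<le> t \<Longrightarrow> dist (h s) (h t) = c * (t - s)"
    and s: "\<bar>s\<bar> \<le> d"
  shows "h s = (1/2) *\<^sub>R (h d + h (-d)) + (s / (2 * d)) *\<^sub>R (h d - h (-d))"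
proof -
  have n: "norm (h s - h (-d)) = c * (s + d)" "norm (h d - h s) = c * (d - s)" "norm (h d - h (-d)) = c * (2 * d)"
    using dist[of "-d" s] dist[of s d] dist[of "-d" d] d s by (auto simp: dist_norm norm_minus_commute)
  have "norm ((h s - h (-d)) + (h d - h s)) = norm (h s - h (-d)) + norm (h d - h s)"
    using n by (simp add: algebra_simps)
  then have "norm (h s - h (-d)) *\<^sub>R (h d - h s) = norm (h d - h s) *\<^sub>R (h s - h (-d))"
    by (rule norm_triangle_eq[THEN iffD1])
  then have "c *\<^sub>R ((s + d) *\<^sub>R (h d - h s)) = c *\<^sub>R ((d - s) *\<^sub>R (h s - h (-d)))"
    unfolding n scaleR_scaleR .
  then have "(s + d) *\<^sub>R (h d - h s) = (d - s) *\<^sub>R (h s - h (-d))"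
    by (rule scaleR_left_imp_eq[rotated]) (use c in simp)
  then have "d *\<^sub>R h s + d *\<^sub>R h s = (s + d) *\<^sub>R h d + (d - s) *\<^sub>R h (-d)" by (simp add: algebra_simps)
  then have "(2 * d) *\<^sub>R h s = (s + d) *\<^sub>R h d + (d - s) *\<^sub>R h (-d)"
    by (simp only: mult_2 scaleR_add_left)
  also have "\<dots> = d *\<^sub>R (h d + h (-d)) + s *\<^sub>R (h d - h (-d))"
    by (simp add: algebra_simps)
  also have "\<dots> = (2 * d) *\<^sub>R ((1/2) *\<^sub>R (h d + h (-d)) + (s / (2 * d)) *\<^sub>R (h d - h (-d)))"
    unfolding scaleR_add_right[of "2 * d"] scaleR_scaleR using d by simp
  finally show ?thesis by (rule scaleR_left_imp_eq[rotated]) (use d in simp)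
qed

lemma dist_saddle: "(dist (saddle (u, v)) (saddle (u', v')))\<^sup>2 = (u - u')\<^sup>2 + (v - v')\<^sup>2 + (u * v - u' * v')\<^sup>2"
  by (simp add: dist_norm norm_3)

lemma bilinear_interpolation:
  fixes A B C D :: "'a::real_vector"
  shows "(1/2) *\<^sub>R (((1/2) *\<^sub>R (A + B) + q *\<^sub>R (A - B)) + ((1/2) *\<^sub>R (C + D) + q *\<^sub>R (C - D)))
      + p *\<^sub>R (((1/2) *\<^sub>R (A + B) + q *\<^sub>R (A - B)) - ((1/2) *\<^sub>R (C + D) + q *\<^sub>R (C - D)))
    = (1/4) *\<^sub>R (A + C + B + D) + (p/2) *\<^sub>R (A - C + B - D)
      + (q/2) *\<^sub>R (A + C - B - D) + (p * q) *\<^sub>R (A - C - B + D)"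
  by (simp add: algebra_simps)

text \<open>The affine map that carries the origin to \<open>b\<close> and the coordinate vectors to \<open>e1\<close>, \<open>e2\<close>, \<open>e3\<close>.\<close>

fun place :: "'a \<times> 'a \<times> 'a \<times> 'a \<Rightarrow> real ^ 3 \<Rightarrow> 'a::real_inner" where
  "place (b, e1, e2, e3) x = b + (x $ 1) *\<^sub>R e1 + (x $ 2) *\<^sub>R e2 + (x $ 3) *\<^sub>R e3"

fun orthonormal_frame :: "'a \<times> 'a \<times> 'a \<times> 'a::real_inner \<Rightarrow> bool" where
  "orthonormal_frame (b, e1, e2, e3) \<longleftrightarrow> e1 \<bullet> e1 = 1 \<and> e2 \<bullet> e2 = 1 \<and> e3 \<bullet> e3 = 1 \<and>
    e1 \<bullet> e2 = 0 \<and> e1 \<bullet> e3 = 0 \<and> e2 \<bullet> e3 = 0"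

text \<open>By continuity the rulings keep their lengths as well, so \<open>g\<close> moves with constant speed and hence
affinely along both families of rulings: locally
\<open>g (u0 + p, v0 + q) = m + p a + q b + p q c\<close>. The squared lengths of the rulings, which
are quadratic in the other parameter, yield the inner products of \<open>a\<close> and \<open>b\<close> with themselves and
with \<open>c\<close>, and the diagonal chord yields that of \<open>a\<close> with \<open>b\<close>. They are the inner products of the
partial derivatives \<open>(1, 0, v0)\<close>, \<open>(0, 1, u0)\<close> and the mixed derivative \<open>(0, 0, 1)\<close> of the saddle.\<close>

lemma comparable_chords_rigid:
  fixes g :: "real \<times> real \<Rightarrow> 'a::real_inner"
  assumes g: "continuous_on UNIV g" and r: "r > 0"
    and chord: "\<And>w w'. w \<in> ball w0 r \<Longrightarrow> w' \<in> ball w0 r \<Longrightarrow>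
      (fst w' - fst w) * (snd w' - snd w) > 0 \<Longrightarrow> dist (g w) (g w') = dist (saddle w) (saddle w')"
  obtains r' F where "r' > 0" "orthonormal_frame F" "\<And>w. w \<in> ball w0 r' \<Longrightarrow> g w = place F (saddle w)"
proof -
  have weak: "dist (g w) (g w') = dist (saddle w) (saddle w')"
    if "w \<in> ball w0 r" "w' \<in> ball w0 r" "fst w \<le> fst w'" "snd w \<le> snd w'" for w w'
  proof (rule tendsto_unique)
    let ?w = "\<lambda>t::real. (fst w' + t, snd w' + t)"
    have lim: "(?w \<longlongrightarrow> w') (at_right 0)"
    proof -
      have "(?w \<longlongrightarrow> (fst w' + 0, snd w' + 0)) (at_right 0)" by (intro tendsto_intros)
      then show ?thesis by simp
    qed
    show "((\<lambda>t. dist (g w) (g (?w t))) \<longlongrightarrow> dist (g w) (g w')) (at_right 0)"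
      by (intro tendsto_intros continuous_on_tendsto_compose[OF g lim]) auto
    have near: "\<forall>\<^sub>F t in at_right 0. ?w t \<in> ball w0 r" using topological_tendstoD[OF lim open_ball that(2)] .
    have "\<forall>\<^sub>F t in at_right 0. dist (saddle w) (saddle (?w t)) = dist (g w) (g (?w t))"
      using near eventually_at_right_less[of 0]
    proof eventually_elim
      case (elim t)
      then have "(fst (?w t) - fst w) * (snd (?w t) - snd w) > 0" using that by (intro mult_pos_pos) auto
      from chord[OF that(1) elim(1) this] show ?case by simp
    qed
    moreover have "((\<lambda>t. dist (saddle w) (saddle (?w t))) \<longlongrightarrow> dist (saddle w) (saddle w')) (at_right 0)"
      by (intro tendsto_intros continuous_on_tendsto_compose[OF continuous_saddle[of UNIV] lim]) auto
    ultimately show "((\<lambda>t. dist (g w) (g (?w t))) \<longlongrightarrow> dist (saddle w) (saddle w')) (at_right 0)"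
      by (rule Lim_transform_eventually[rotated])
  qed simp
  obtain u0 v0 where w0: "w0 = (u0, v0)" by (cases w0)
  define d where "d = r / 3"
  have d: "d > 0" using r by (simp add: d_def)
  have box: "(u0 + p, v0 + q) \<in> ball w0 r" if "\<bar>p\<bar> \<le> d" "\<bar>q\<bar> \<le> d" for p q
  proof -
    have "dist (u0, v0) (u0 + p, v0 + q) \<le> \<bar>p\<bar> + \<bar>q\<bar>"
      using sqrt_sum_squares_le_sum_abs[of p q] by (simp add: dist_Pair_Pair dist_real_def)
    then show ?thesis using that r unfolding w0 d_def by simp
  qed
  define h where "h p q = g (u0 + p, v0 + q)" for p q
  have h_dist: "dist (h p q) (h p' q') = dist (saddle (u0 + p, v0 + q)) (saddle (u0 + p', v0 + q'))"
    if "\<bar>p\<bar> \<le> d" "\<bar>q\<bar> \<le> d" "\<bar>p'\<bar> \<le> d" "\<bar>q'\<bar> \<le> d" "p \<le> p'" "q \<le> q'" for p q p' q'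
    unfolding h_def using that by (intro weak box) auto
  have row: "dist (h p q) (h p' q) = sqrt (1 + (v0 + q)\<^sup>2) * (p' - p)"
    if "\<bar>p\<bar> \<le> d" "\<bar>p'\<bar> \<le> d" "p \<le> p'" "\<bar>q\<bar> \<le> d" for p p' q
  proof -
    have "(dist (h p q) (h p' q))\<^sup>2 = (sqrt (1 + (v0 + q)\<^sup>2) * (p' - p))\<^sup>2"
      using that by (simp add: h_dist dist_saddle power_mult_distrib) (simp add: power2_eq_square algebra_simps)
    then show ?thesis using that by (simp add: power2_eq_iff_nonneg)
  qed
  have col: "dist (h p q) (h p q') = sqrt (1 + (u0 + p)\<^sup>2) * (q' - q)"
    if "\<bar>q\<bar> \<le> d" "\<bar>q'\<bar> \<le> d" "q \<le> q'" "\<bar>p\<bar> \<le> d" for p q q'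
  proof -
    have "(dist (h p q) (h p q'))\<^sup>2 = (sqrt (1 + (u0 + p)\<^sup>2) * (q' - q))\<^sup>2"
      using that by (simp add: h_dist dist_saddle power_mult_distrib) (simp add: power2_eq_square algebra_simps)
    then show ?thesis using that by (simp add: power2_eq_iff_nonneg)
  qed
  have pos: "sqrt (1 + x\<^sup>2) > 0" for x :: real by (simp add: add_pos_nonneg)
  have rows: "h p q = (1/2) *\<^sub>R (h d q + h (-d) q) + (p / (2 * d)) *\<^sub>R (h d q - h (-d) q)"
    if "\<bar>p\<bar> \<le> d" "\<bar>q\<bar> \<le> d" for p q
    by (rule constant_speed_affine[of d "sqrt (1 + (v0 + q)\<^sup>2)" "\<lambda>p. h p q"])
       (use that row d pos in auto)
  have cols: "h p q = (1/2) *\<^sub>R (h p d + h p (-d)) + (q / (2 * d)) *\<^sub>R (h p d - h p (-d))"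
    if "\<bar>p\<bar> \<le> d" "\<bar>q\<bar> \<le> d" for p q
    by (rule constant_speed_affine[of d "sqrt (1 + (u0 + p)\<^sup>2)" "h p"])
       (use that col d pos in auto)
  define m where "m = (1/4) *\<^sub>R (h d d + h (-d) d + h d (-d) + h (-d) (-d))"
  define a where "a = (1 / (4 * d)) *\<^sub>R (h d d - h (-d) d + h d (-d) - h (-d) (-d))"
  define b where "b = (1 / (4 * d)) *\<^sub>R (h d d + h (-d) d - h d (-d) - h (-d) (-d))"
  define c where "c = (1 / (4 * d\<^sup>2)) *\<^sub>R (h d d - h (-d) d - h d (-d) + h (-d) (-d))"
  have biaffine: "h p q = m + p *\<^sub>R a + q *\<^sub>R b + (p * q) *\<^sub>R c" if "\<bar>p\<bar> \<le> d" "\<bar>q\<bar> \<le> d" for p q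
  proof -
    let ?P = "p / (2 * d)" and ?Q = "q / (2 * d)"
    have e: "p *\<^sub>R a = (?P / 2) *\<^sub>R (h d d - h (-d) d + h d (-d) - h (-d) (-d))"
      "q *\<^sub>R b = (?Q / 2) *\<^sub>R (h d d + h (-d) d - h d (-d) - h (-d) (-d))"
      "(p * q) *\<^sub>R c = (?P * ?Q) *\<^sub>R (h d d - h (-d) d - h d (-d) + h (-d) (-d))"
      unfolding a_def b_def c_def using d by (simp_all add: field_simps power2_eq_square)
    have "h d q = (1/2) *\<^sub>R (h d d + h d (-d)) + ?Q *\<^sub>R (h d d - h d (-d))"
      "h (-d) q = (1/2) *\<^sub>R (h (-d) d + h (-d) (-d)) + ?Q *\<^sub>R (h (-d) d - h (-d) (-d))"
      using cols[of d q] cols[of "-d" q] that d by auto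
    then show ?thesis
      by (simp only: rows[OF that] e m_def bilinear_interpolation)
  qed
  have square_of_sum: "(x + t *\<^sub>R y) \<bullet> (x + t *\<^sub>R y) = x \<bullet> x + 2 * t * (x \<bullet> y) + t\<^sup>2 * (y \<bullet> y)" for t and x y :: 'a
    by (simp add: inner_add_left inner_add_right inner_commute[of y x] power2_eq_square distrib_left)
  have along_row: "a \<bullet> a + 2 * q * (a \<bullet> c) + q\<^sup>2 * (c \<bullet> c) = 1 + (v0 + q)\<^sup>2" if "\<bar>q\<bar> \<le> d" for q
  proof -
    have e: "h d q = m + d *\<^sub>R a + q *\<^sub>R b + (d * q) *\<^sub>R c"
      "h (-d) q = m + (-d) *\<^sub>R a + q *\<^sub>R b + (-d * q) *\<^sub>R c"
      using biaffine that d by auto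
    have "h d q - h (-d) q = d *\<^sub>R (a + q *\<^sub>R c) + d *\<^sub>R (a + q *\<^sub>R c)"
      unfolding e by (simp add: algebra_simps)
    then have "h d q - h (-d) q = (2 * d) *\<^sub>R (a + q *\<^sub>R c)"
      by (simp only: mult_2 scaleR_add_left)
    then have "norm (h (-d) q - h d q) = (2 * d) * norm (a + q *\<^sub>R c)"
      using d by (simp add: norm_minus_commute[of "h (-d) q"])
    then have "norm (a + q *\<^sub>R c) = sqrt (1 + (v0 + q)\<^sup>2)"
      using row[of "-d" d q] that d by (simp add: dist_norm)
    then show ?thesis unfolding square_of_sum[symmetric] by (simp add: dot_square_norm)
  qed
  have along_col: "b \<bullet> b + 2 * p * (b \<bullet> c) + p\<^sup>2 * (c \<bullet> c) = 1 + (u0 + p)\<^sup>2" if "\<bar>p\<bar> \<le> d" for p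
  proof -
    have e: "h p d = m + p *\<^sub>R a + d *\<^sub>R b + (p * d) *\<^sub>R c"
      "h p (-d) = m + p *\<^sub>R a + (-d) *\<^sub>R b + (p * -d) *\<^sub>R c"
      using biaffine that d by auto
    have "h p d - h p (-d) = d *\<^sub>R (b + p *\<^sub>R c) + d *\<^sub>R (b + p *\<^sub>R c)"
      unfolding e by (simp add: algebra_simps)
    then have "h p d - h p (-d) = (2 * d) *\<^sub>R (b + p *\<^sub>R c)"
      by (simp only: mult_2 scaleR_add_left)
    then have "norm (h p (-d) - h p d) = (2 * d) * norm (b + p *\<^sub>R c)"
      using d by (simp add: norm_minus_commute[of "h p (-d)"])
    then have "norm (b + p *\<^sub>R c) = sqrt (1 + (u0 + p)\<^sup>2)"
      using col[of "-d" d p] that d by (simp add: dist_norm)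
    then show ?thesis unfolding square_of_sum[symmetric] by (simp add: dot_square_norm)
  qed
  have quadratic: "x = y0 \<and> y = 1"
    if "z = 1 + y0\<^sup>2" "z + 2 * d * x + d\<^sup>2 * y = 1 + (y0 + d)\<^sup>2" "z + 2 * (-d) * x + (-d)\<^sup>2 * y = 1 + (y0 + (-d))\<^sup>2"
    for x y y0 z :: real
  proof -
    have "(y0 + d)\<^sup>2 = y0\<^sup>2 + d\<^sup>2 + 2 * (d * y0)" "(y0 + (-d))\<^sup>2 = y0\<^sup>2 + d\<^sup>2 - 2 * (d * y0)"
      by (simp_all add: power2_eq_square algebra_simps)
    moreover have "z + 2 * (d * x) + d\<^sup>2 * y = 1 + (y0 + d)\<^sup>2" "z - 2 * (d * x) + d\<^sup>2 * y = 1 + (y0 + (-d))\<^sup>2"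
      using that(2,3) by (simp_all add: mult.assoc)
    ultimately have "d * x = d * y0" "d\<^sup>2 * y = d\<^sup>2" using that(1) by linarith+
    then show ?thesis using d by simp
  qed
  have aa: "a \<bullet> a = 1 + v0\<^sup>2" using along_row[of 0] d by simp
  have ac: "a \<bullet> c = v0 \<and> c \<bullet> c = 1"
  proof (rule quadratic[OF aa])
    show "a \<bullet> a + 2 * d * (a \<bullet> c) + d\<^sup>2 * (c \<bullet> c) = 1 + (v0 + d)\<^sup>2"
      by (rule along_row) (use d in simp)
    show "a \<bullet> a + 2 * (-d) * (a \<bullet> c) + (-d)\<^sup>2 * (c \<bullet> c) = 1 + (v0 + (-d))\<^sup>2"
      by (rule along_row) (use d in simp)
  qed
  have bb: "b \<bullet> b = 1 + u0\<^sup>2" using along_col[of 0] d by simp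
  have bc: "b \<bullet> c = u0 \<and> c \<bullet> c = 1"
  proof (rule quadratic[OF bb])
    show "b \<bullet> b + 2 * d * (b \<bullet> c) + d\<^sup>2 * (c \<bullet> c) = 1 + (u0 + d)\<^sup>2"
      by (rule along_col) (use d in simp)
    show "b \<bullet> b + 2 * (-d) * (b \<bullet> c) + (-d)\<^sup>2 * (c \<bullet> c) = 1 + (u0 + (-d))\<^sup>2"
      by (rule along_col) (use d in simp)
  qed
  have ab: "a \<bullet> b = u0 * v0"
  proof -
    have e: "h d d = m + d *\<^sub>R a + d *\<^sub>R b + (d * d) *\<^sub>R c"
      "h (-d) (-d) = m + (-d) *\<^sub>R a + (-d) *\<^sub>R b + (-d * -d) *\<^sub>R c"
      using biaffine d by auto
    have "h d d - h (-d) (-d) = d *\<^sub>R (a + b) + d *\<^sub>R (a + b)"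
      unfolding e by (simp add: algebra_simps)
    then have "h d d - h (-d) (-d) = (2 * d) *\<^sub>R (a + b)"
      by (simp only: mult_2 scaleR_add_left)
    then have "(norm (h (-d) (-d) - h d d))\<^sup>2 = (2 * d)\<^sup>2 * ((a + b) \<bullet> (a + b))"
      using d by (simp add: norm_minus_commute[of "h (-d) (-d)"] power_mult_distrib dot_square_norm)
    moreover have "(norm (h (-d) (-d) - h d d))\<^sup>2 = (2 * d)\<^sup>2 * (2 + (u0 + v0)\<^sup>2)"
      using h_dist[of "-d" "-d" d d] d
      by (simp add: dist_norm[symmetric] dist_saddle) (simp add: power2_eq_square algebra_simps)
    ultimately have "(a + b) \<bullet> (a + b) = 2 + (u0 + v0)\<^sup>2" using d by simp
    moreover have "(a + b) \<bullet> (a + b) = a \<bullet> a + b \<bullet> b + 2 * (a \<bullet> b)"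
      by (simp add: inner_add_left inner_add_right inner_commute[of b a])
    moreover have "(u0 + v0)\<^sup>2 = u0\<^sup>2 + v0\<^sup>2 + 2 * (u0 * v0)" by (simp add: power2_sum)
    ultimately show ?thesis using aa bb by linarith
  qed
  \<comment> \<open>The vectors \<open>a\<close>, \<open>b\<close>, \<open>c\<close> are those derivatives seen in the frame, which is solved for here.\<close>
  define F where "F = (m - u0 *\<^sub>R a - v0 *\<^sub>R b + (u0 * v0) *\<^sub>R c, a - v0 *\<^sub>R c, b - u0 *\<^sub>R c, c)"
  show ?thesis
  proof (rule that[OF d])
    show "orthonormal_frame F"
      using aa ac bb bc ab unfolding F_def
      by (simp add: inner_diff_left inner_diff_right inner_commute[of c a] inner_commute[of c b] inner_commute[of b a]
          power2_eq_square)
    fix w assume w: "w \<in> ball w0 d"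
    have "\<bar>fst w - u0\<bar> \<le> d" "\<bar>snd w - v0\<bar> \<le> d"
      using w dist_fst_le[of w w0] dist_snd_le[of w w0] unfolding w0 by (auto simp: dist_real_def dist_commute)
    from biaffine[OF this] show "g w = place F (saddle w)"
      unfolding h_def F_def by (simp add: algebra_simps)
  qed
qed

text \<open>The four functions \<open>1\<close>, \<open>u\<close>, \<open>v\<close>, \<open>u v\<close> are linearly independent on every open set, as differences
over a small square show.\<close>

lemma place_saddle_unique:
  assumes r: "r > 0" and eq: "\<And>w. w \<in> ball w0 r \<Longrightarrow> place F (saddle w) = place F' (saddle w)"
  shows "F = F'"
proof -
  obtain b e1 e2 e3 where F: "F = (b, e1, e2, e3)" by (cases F)
  obtain b' e1' e2' e3' where F': "F' = (b', e1', e2', e3')" by (cases F')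
  obtain u v where w0: "w0 = (u, v)" by (cases w0)
  define d where "d = r / 3"
  have d: "d > 0" using r by (simp add: d_def)
  define k where "k p q = (b - b') + p *\<^sub>R (e1 - e1') + q *\<^sub>R (e2 - e2') + (p * q) *\<^sub>R (e3 - e3')" for p q
  have k0: "k p q = 0" if "(p, q) \<in> ball w0 r" for p q
    using eq[OF that] unfolding k_def F F' by (simp add: algebra_simps)
  have near: "(u, v) \<in> ball w0 r" "(u + d, v) \<in> ball w0 r" "(u, v + d) \<in> ball w0 r" "(u + d, v + d) \<in> ball w0 r"
    using d r sqrt_sum_squares_le_sum_abs[of d d] unfolding w0 by (auto simp: dist_Pair_Pair dist_real_def d_def)
  have "(d * d) *\<^sub>R (e3 - e3') = k (u + d) (v + d) - k (u + d) v - k u (v + d) + k u v"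
    unfolding k_def by (simp add: algebra_simps)
  then have 3: "e3 = e3'" using k0 near d by simp
  have "d *\<^sub>R (e1 - e1') = k (u + d) v - k u v" "d *\<^sub>R (e2 - e2') = k u (v + d) - k u v"
    unfolding k_def 3 by (simp_all add: algebra_simps)
  then have 12: "e1 = e1'" "e2 = e2'" using k0 near d by simp_all
  have "b = b'" using k0[OF near(1)] unfolding k_def 3 12 by simp
  with 3 12 show ?thesis unfolding F F' by simp
qed

lemma dist_place:
  assumes "orthonormal_frame F" shows "dist (place F x) (place F y) = dist x y"
proof -
  obtain b e1 e2 e3 where F: "F = (b, e1, e2, e3)" by (cases F)
  define p where "p = x $ 1 - y $ 1"
  define q where "q = x $ 2 - y $ 2"
  define s where "s = x $ 3 - y $ 3"
  have "place F x - place F y = p *\<^sub>R e1 + q *\<^sub>R e2 + s *\<^sub>R e3"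
    unfolding F p_def q_def s_def by (simp add: algebra_simps)
  moreover have "(p *\<^sub>R e1 + q *\<^sub>R e2 + s *\<^sub>R e3) \<bullet> (p *\<^sub>R e1 + q *\<^sub>R e2 + s *\<^sub>R e3) = p\<^sup>2 + q\<^sup>2 + s\<^sup>2"
    using assms unfolding F
    by (simp add: inner_add_left inner_add_right inner_commute[of e2 e1]
        inner_commute[of e3 e1] inner_commute[of e3 e2] power2_eq_square)
  ultimately show ?thesis
    by (simp add: dist_norm norm_3 p_def q_def s_def) (simp add: norm_eq_sqrt_inner)
qed

lemma open_place:
  fixes F :: "(real ^ 3) \<times> (real ^ 3) \<times> (real ^ 3) \<times> (real ^ 3)"
  assumes F: "orthonormal_frame F" shows "surj (place F)" "open S \<Longrightarrow> open (place F ` S)"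
proof -
  define T where "T x = place F x - place F 0" for x
  have "linear T"
    by (cases F, rule linearI) (auto simp: T_def algebra_simps)
  moreover have "inj T" using dist_place[OF F] unfolding T_def inj_def by (metis dist_eq_0_iff diff_add_cancel)
  ultimately have surj: "surj T" by (intro linear_injective_imp_surjective) simp_all
  have eq: "place F = (\<lambda>x. place F 0 + x) \<circ> T" by (auto simp: T_def)
  show "surj (place F)" using surj eq by (metis comp_surj surj_plus)
  show "open (place F ` S)" if "open S"
  proof -
    have "place F ` S = (\<lambda>x. place F 0 + x) ` (T ` S)" using eq by (metis image_comp)
    then show ?thesis using open_translation open_surjective_linear_image[OF that \<open>linear T\<close> surj] by metis
  qed
qed

text \<open>The local frames agree where their domains overlap, so the frame is locally constant on the plane.\<close>

lemma (in saddle_boundary_isometry) g_rigid: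
  obtains F where "orthonormal_frame F" "\<And>w. g w = place F (saddle w)"
proof -
  have "\<exists>F r. r > 0 \<and> orthonormal_frame F \<and> (\<forall>w\<in>ball w0 r. g w = place F (saddle w))" for w0
  proof -
    obtain r where r: "r > 0" "\<And>w w'. w \<in> ball w0 r \<Longrightarrow> w' \<in> ball w0 r \<Longrightarrow>
      (fst w' - fst w) * (snd w' - snd w) > 0 \<Longrightarrow> dist (g w) (g w') = dist (saddle w) (saddle w')"
      using visible_chord_length[of w0] by blast
    show ?thesis
      by (rule comparable_chords_rigid[OF continuous_g r(1), of w0]) (rule r(2), assumption+, blast)
  qed
  then have "\<forall>w0. \<exists>F r. r > 0 \<and> orthonormal_frame F \<and> (\<forall>w\<in>ball w0 r. g w = place F (saddle w))"
    by blast
  from choice[OF this] obtain F where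
    "\<forall>w0. \<exists>r>0. orthonormal_frame (F w0) \<and> (\<forall>w\<in>ball w0 r. g w = place (F w0) (saddle w))" ..
  from choice[OF this] obtain r where
    r: "\<forall>w0. r w0 > 0 \<and> orthonormal_frame (F w0) \<and> (\<forall>w\<in>ball w0 (r w0). g w = place (F w0) (saddle w))" ..
  then have F: "r w0 > 0" "orthonormal_frame (F w0)" "w \<in> ball w0 (r w0) \<Longrightarrow> g w = place (F w0) (saddle w)" for w0 w
    by blast+
  have "F constant_on UNIV"
  proof (rule locally_constant_imp_constant)
    fix a :: "real \<times> real"
    have "F x = F a" if "x \<in> ball a (r a)" for x
    proof -
      have "open (ball a (r a) \<inter> ball x (r x))" by blast
      moreover have "x \<in> ball a (r a) \<inter> ball x (r x)" using that F(1) by simp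
      ultimately obtain s where s: "s > 0" "ball x s \<subseteq> ball a (r a) \<inter> ball x (r x)" using openE by blast
      show ?thesis
      proof (rule place_saddle_unique[OF s(1)])
        fix w assume "w \<in> ball x s"
        then have w: "w \<in> ball x (r x)" "w \<in> ball a (r a)" using s(2) by blast+
        show "place (F x) (saddle w) = place (F a) (saddle w)"
          by (rule trans[OF F(3)[OF w(1), symmetric] F(3)[OF w(2)]])
      qed
    qed
    moreover have "openin (top_of_set UNIV) (ball a (r a))" "a \<in> ball a (r a)" using F(1) by simp_all
    ultimately show "\<exists>T. openin (top_of_set UNIV) T \<and> a \<in> T \<and> (\<forall>x\<in>T. F x = F a)" by blast
  qed (rule connected_UNIV)
  then obtain G where G: "\<And>w. F w = G" unfolding constant_on_def by blast
  show ?thesis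
  proof (rule that[of G])
    show "orthonormal_frame G" using F(2)[of 0] unfolding G .
    show "g w = place G (saddle w)" for w using F(3)[of w w] F(1)[of w] unfolding G by simp
  qed
qed

text \<open>An open connected set is contained in one side of its frontier, and a connected side that meets
the set without being contained in it would meet its frontier.\<close>

lemma connected_open_frontier_cases:
  assumes "open V" "connected V" "V \<noteq> {}" and "open P" "open N" "connected P" "connected N"
    and "P \<inter> N = {}" and cover: "P \<union> N = - frontier V"
  shows "V = P \<or> V = N"
proof -
  have fV: "frontier V \<inter> V = {}" unfolding frontier_def interior_open[OF assms(1)] by blast
  have whole: "V = Q" if Q: "connected Q" "Q \<inter> frontier V = {}" "V \<subseteq> Q" for Q
  proof (rule ccontr)
    assume "V \<noteq> Q"
    have "Q \<inter> V \<noteq> {}" using Q(3) assms(3) by blast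
    moreover have "Q - V \<noteq> {}" using Q(3) \<open>V \<noteq> Q\<close> by blast
    ultimately have "Q \<inter> frontier V \<noteq> {}" by (rule connected_Int_frontier[OF Q(1)])
    then show False using Q(2) by simp
  qed
  have sub: "V \<subseteq> P \<union> N" using cover fV by blast
  have "P \<inter> V = {} \<or> N \<inter> V = {}"
    by (rule connectedD[OF assms(2,4,5) _ sub]) (use assms(8) in blast)
  then have "V \<subseteq> P \<or> V \<subseteq> N" using sub by blast
  moreover have "P \<inter> frontier V = {}" "N \<inter> frontier V = {}" using cover by blast+
  ultimately show ?thesis using whole[OF assms(6)] whole[OF assms(7)] by auto
qed

text \<open>The frontier of \<open>V\<close> is a congruent copy of the saddle, so \<open>V\<close> is a copy of one of its two sides, and
the sides are congruent to each other by the half-turn.\<close>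

lemma (in saddle_boundary_isometry) congruent_to_above_saddle:
  assumes "connected V" shows "euclidean_isometric above_saddle V"
proof -
  obtain F where F: "orthonormal_frame F" "\<And>w. g w = place F (saddle w)" using g_rigid by blast
  have inj: "inj (place F)" using dist_place[OF F(1)] unfolding inj_def by (metis dist_eq_0_iff)
  have "range g = place F ` range saddle" unfolding image_image by (rule image_cong[OF refl F(2)])
  then have frontier: "frontier V = place F ` range saddle" using range_g by simp
  have cont: "continuous_on S (place F)" for S
    unfolding continuous_on_iff dist_place[OF F(1)] by blast
  have split: "above_saddle \<union> below_saddle = - range saddle" "above_saddle \<inter> below_saddle = {}"
    by (auto simp: range_saddle above_saddle_def below_saddle_def)
  have "V = place F ` above_saddle \<or> V = place F ` below_saddle"
  proof (rule connected_open_frontier_cases)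
    show "open V" "connected V" by (fact open_V assms)+
    show "V \<noteq> {}" using g_frontier[of 0] by auto
    show "open (place F ` above_saddle)" "open (place F ` below_saddle)"
      by (rule open_place(2)[OF F(1) open_above_saddle], rule open_place(2)[OF F(1) open_below_saddle])
    show "connected (place F ` above_saddle)" "connected (place F ` below_saddle)"
      by (rule connected_continuous_image[OF cont connected_above_saddle],
          rule connected_continuous_image[OF cont connected_below_saddle])
    show "place F ` above_saddle \<inter> place F ` below_saddle = {}"
      unfolding image_Int[OF inj, symmetric] split(2) by simp
    show "place F ` above_saddle \<union> place F ` below_saddle = - frontier V"
      unfolding frontier image_Un[symmetric] split(1)
      by (rule bij_image_Compl_eq[OF bijI[OF inj open_place(1)[OF F(1)]]])
  qed
  then show ?thesis
  proof
    assume "V = place F ` above_saddle"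
    then show ?thesis unfolding euclidean_isometric_def
      by (intro exI[of _ "place F"] conjI allI dist_place[OF F(1)]) simp
  next
    assume "V = place F ` below_saddle"
    then have "(place F \<circ> flip) ` above_saddle = V" unfolding image_comp[symmetric] flip_above_saddle ..
    moreover have "\<forall>x y. dist ((place F \<circ> flip) x) ((place F \<circ> flip) y) = dist x y"
      using dist_place[OF F(1)] dist_flip by simp
    ultimately show ?thesis unfolding euclidean_isometric_def by blast
  qed
qed

theorem theorem4p4:
  shows "\<exists>U :: (real ^ 3) set.
    is_domain U \<and> smooth_boundary U \<and>
    uniquely_determined_in smooth_domains U \<and> \<not> convex U"
proof (intro exI conjI)
  show dom: "is_domain above_saddle"
    unfolding is_domain_def using open_above_saddle connected_above_saddle by blast
  show "smooth_boundary above_saddle" by (rule smooth_boundary_above_saddle)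
  show "\<not> convex above_saddle" by (rule above_saddle_not_convex)
  show "uniquely_determined_in smooth_domains above_saddle"
    unfolding uniquely_determined_in_def
  proof (intro conjI ballI impI)
    show "above_saddle \<in> smooth_domains"
      using dom smooth_boundary_above_saddle by (simp add: smooth_domains_def)
    fix V :: "(real ^ 3) set"
    assume V: "V \<in> smooth_domains" and "locally_isometric_boundaries above_saddle V"
    then obtain f where f: "bij_betw f (frontier above_saddle) (frontier V)"
      "\<forall>y\<in>frontier above_saddle. \<exists>\<epsilon>::real. \<epsilon> > 0 \<and>
        (\<forall>a\<in>{z \<in> frontier above_saddle. relative_metric above_saddle z y < ennreal \<epsilon>}.
         \<forall>b\<in>{z \<in> frontier above_saddle. relative_metric above_saddle z y < ennreal \<epsilon>}.
          relative_metric above_saddle a b = relative_metric V (f a) (f b))"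
      unfolding locally_isometric_boundaries_def by (elim exE conjE)
    have V': "open V" "connected V" "C1_submanifold 2 (frontier V)"
      using V by (simp_all add: smooth_domains_def is_domain_def smooth_boundary_def)
    interpret saddle_boundary_isometry V f
      by unfold_locales (rule V', rule V', rule f(1)[unfolded frontier_above_saddle], rule f(2)[unfolded frontier_above_saddle])
    show "euclidean_isometric above_saddle V"
      by (rule congruent_to_above_saddle) (rule V'(2))
  qed
qed

end
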